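(* Let $A$ be a finite-dimensional unital commutative Frobenius algebra over a field $K$, with symmetric non-degenerate Frobenius form $\eta$, counit $\epsilon$, comultiplication $\delta$ and Euler element $\mathbf{e}$. Let $\Omega$ be an assignment which, for all $g\ge 0$ and $n\ge 1$, associates to each connected cell graph $\gamma\in\Gamma_{g,n}$ a multilinear map $\Omega(\gamma):A^{\otimes n}\to K$, and which satisfies the edge-contraction axioms ECA 0, ECA 1 and ECA 2. Then for all $g\ge 0$, $n\ge 1$, every connected cell graph $\gamma\in\Gamma_{g,n}$ and all $v_1,\dots,v_n\in A$, $$\Omega(\gamma)(v_1,\dots,v_n)=\epsilon(v_1v_2\cdots v_n\,\mathbf{e}^g).$$ That is, all $\gamma\in\Gamma_{g,n}$ give rise to the same map. In particular, $\Omega(\gamma)(v_1,\dots,v_n)$ is symmetric with respect to permutations of the indices.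
   Context: Frobenius algebra. $A$ is a finite-dimensional, unital, associative, commutative algebra over a field $K$, with multiplication $m(u,v)=uv$, unit $\mathbf 1$, and a symmetric non-degenerate bilinear form $\eta:A\otimes A\to K$ with $\eta(v_1,v_2v_3)=\eta(v_1v_2,v_3)$. The counit is $\epsilon(v)=\eta(\mathbf 1,v)$. For a basis $e_1,\dots,e_r$ of $A$ put $\eta_{ij}=\eta(e_i,e_j)$ and $[\eta^{ij}]=[\eta_{ij}]^{-1}$. The comultiplication $\delta:A\to A\otimes A$ is $\delta(v)=\sum_{i,j,a,b}\eta(v,e_ie_j)\eta^{ia}\eta^{jb}\,e_a\otimes e_b$. The Euler element is $\mathbf e=m(\delta(\mathbf 1))=\sum_{a,b}\eta^{ab}e_ae_b$. Cell graphs. A connected cell graph of type $(g,n)$ is the $1$-skeleton of a cell-decomposition of a connected compact oriented topological surface of genus $g$ with $n$ $0$-cells labeled $1,\dots,n$; $0$-cells, $1$-cells and $2$-cells are called vertices, edges and faces. Two cell graphs are identified if a(n orientation-preserving) homeomorphism of the surfaces carries one cell-decomposition to the other preserving vertex labels. Equivalently, a cell graph is a connected graph with labeled vertices (multiple edges and loops allowed) together with a cyclic order on the half-edges incident to each vertex; its genus is given by $n-\#\text{edges}+\#\text{faces}=2-2g$. The graph with one vertex and no edges is a cell graph of type $(0,1)$. $\Gamma_{g,n}$ is the set of connected cell graphs of type $(g,n)$. Edge-contraction operations. (i) If $E$ is an edge joining distinct vertices $i<j$, contracting $E$ merges the two vertices into one vertex labeled $i$; if the cyclic orders are $(E,a_1,\dots,a_p)$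 at $i$ and $(E,b_1,\dots,b_q)$ at $j$, the cyclic order at the merged vertex is $(a_1,\dots,a_p,b_1,\dots,b_q)$. The remaining vertices keep their order. The result lies in $\Gamma_{g,n-1}$. (ii) If $L$ is a loop at vertex $i$ with half-edges $h,h'$ and the cyclic order at $i$ is $(h,a_1,\dots,a_p,h',b_1,\dots,b_q)$, contracting $L$ deletes $L$ and replaces vertex $i$ by two vertices with cyclic orders $(a_1,\dots,a_p)$ and $(b_1,\dots,b_q)$, labeled $i$ and $i'$ (in either way), with the ordering $i-1<i<i'<i+1$ of labels. The result $\gamma'$ may be disconnected. Edge-contraction axioms for the assignment $\Omega$ ($v_k\in A$ is attached to the $k$-th vertex; no permutation symmetry of $\Omega(\gamma)$ is assumed): ECA 0: for the graph $\bullet\in\Gamma_{0,1}$ with one vertex and no edges, $\Omega(\bullet)(v)=\epsilon(v)$. ECA 1: if $\gamma'\in\Gamma_{g,n-1}$ is obtained from $\gamma\in\Gamma_{g,n}$ by contracting an edge joining vertices $i<j$, then $\Omega(\gamma)(v_1,\dots,v_n)=\Omega(\gamma')(v_1,\dots,v_{i-1},v_iv_j,v_{i+1},\dots,\widehat{v_j},\dots,v_n)$, where $\widehat{v_j}$ means omission. ECA 2: let $\gamma'$ be obtained from $\gamma\in\Gamma_{g,n}$ by contracting a loop at vertex $i$. If $\gamma'$ is connected, then $\gamma'\in\Gamma_{g-1,n+1}$ and $\Omega(\gamma)(v_1,\dots,v_n)=\Omega(\gamma')(v_1,\dots,v_{i-1},\delta(v_i),v_{i+1},\dots,v_n)$,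 with $\delta(v_i)$ placed in the $i$-th and $i'$-th slots. If $\gamma'$ is disconnected, write $\gamma'=(\gamma_1,\gamma_2)\in\Gamma_{g_1,|I|+1}\times\Gamma_{g_2,|J|+1}$ with $g=g_1+g_2$ and $I\sqcup J=\{1,\dots,\widehat{i},\dots,n\}$, where $I$ (resp. $J$) labels the old vertices of $\gamma_1$ (resp. $\gamma_2$); let $(I_-,i,I_+)$ and $(J_-,i,J_+)$ be the increasing reorderings of $I\sqcup\{i\}$ and $J\sqcup\{i\}$. Then $\Omega(\gamma)(v_1,\dots,v_n)=\sum_{a,b,k,\ell}\eta(v_i,e_ke_\ell)\eta^{ka}\eta^{\ell b}\,\Omega(\gamma_1)(v_{I_-},e_a,v_{I_+})\,\Omega(\gamma_2)(v_{J_-},e_b,v_{J_+})$. *)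

theory Defs
  imports Complex_Main "HOL-Combinatorics.Combinatorics"
begin

section \<open>Frobenius algebras\<close>

text \<open>The sort \<open>{comm_ring, comm_monoid_mult}\<close> is that of commutative unital rings without the
  requirement \<open>0 \<noteq> 1\<close>, so that the zero algebra is included.  \<open>Basis\<close> is an arbitrary basis
  of the algebra.\<close>

locale frobenius_algebra = finite_dimensional_vector_space scale Basis
  for scale :: "'k::field \<Rightarrow> 'a::{comm_ring, comm_monoid_mult} \<Rightarrow> 'a"
    and Basis :: "'a set" +
  fixes \<eta> :: "'a \<Rightarrow> 'a \<Rightarrow> 'k"
  assumes scale_mult_left: "scale c x * y = scale c (x * y)"
    and eta_linear: "Vector_Spaces.linear scale (*) (\<eta> x)"
    and eta_sym: "\<eta> x y = \<eta> y x"
    and eta_nondegenerate: "(\<And>y. \<eta> x y = 0) \<Longrightarrow> x = 0"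
    and eta_mult: "\<eta> x (y * z) = \<eta> (x * y) z"

definition counit :: "('a::one \<Rightarrow> 'a \<Rightarrow> 'k) \<Rightarrow> 'a \<Rightarrow> 'k" where
  "counit \<eta> v = \<eta> 1 v"

text \<open>The matrix \<open>\<eta>\<^sup>i\<^sup>j\<close> inverse to the Gram matrix of the basis \<open>B\<close>; rows and columns are indexed
  by the basis vectors themselves, and only the values on \<open>B \<times> B\<close> are meaningful.\<close>

definition is_gram_inverse :: "'a set \<Rightarrow> ('a \<Rightarrow> 'a \<Rightarrow> 'k::field) \<Rightarrow> ('a \<Rightarrow> 'a \<Rightarrow> 'k) \<Rightarrow> bool" where
  "is_gram_inverse B \<eta> M \<longleftrightarrow>
     (\<forall>x\<in>B. \<forall>y\<in>B. (\<Sum>z\<in>B. \<eta> x z * M z y) = (if x = y then 1 else 0) \<and>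
                 (\<Sum>z\<in>B. M x z * \<eta> z y) = (if x = y then 1 else 0))"

definition gram_inv :: "'a set \<Rightarrow> ('a \<Rightarrow> 'a \<Rightarrow> 'k::field) \<Rightarrow> 'a \<Rightarrow> 'a \<Rightarrow> 'k" where
  "gram_inv B \<eta> = (SOME M. is_gram_inverse B \<eta> M)"

text \<open>An element of \<open>A \<otimes> A\<close> is represented by its coordinates with respect to the basis
  \<open>a \<otimes> b\<close>, \<open>a, b \<in> B\<close>: the comultiplication \<open>\<delta>(v)\<close> is
  \<open>\<Sum>a\<in>B. \<Sum>b\<in>B. comult B \<eta> v a b \<cdot> a \<otimes> b\<close>.\<close>

definition comult ::
  "'a::times set \<Rightarrow> ('a \<Rightarrow> 'a \<Rightarrow> 'k::field) \<Rightarrow> 'a \<Rightarrow> 'a \<Rightarrow> 'a \<Rightarrow> 'k" where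
  "comult B \<eta> v a b =
     (\<Sum>i\<in>B. \<Sum>j\<in>B. \<eta> v (i * j) * gram_inv B \<eta> i a * gram_inv B \<eta> j b)"

text \<open>\<open>m(\<delta>(1))\<close>\<close>

definition euler_element ::
  "('k::field \<Rightarrow> 'a \<Rightarrow> 'a::{comm_ring, comm_monoid_mult}) \<Rightarrow> 'a set \<Rightarrow> ('a \<Rightarrow> 'a \<Rightarrow> 'k) \<Rightarrow> 'a" where
  "euler_element scale B \<eta> = (\<Sum>a\<in>B. \<Sum>b\<in>B. scale (comult B \<eta> 1 a b) (a * b))"


section \<open>Cell graphs\<close>

text \<open>\<open>rot G ! i\<close> lists the half-edges at vertex \<open>i\<close> in their cyclic order (so it only matters up to
  rotation); \<open>opp G\<close> sends a half-edge to the other half of its edge.  Vertices are labelled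
  \<open>0, \<dots>, n - 1\<close>, so that labels are list positions.  A vertex may have no half-edges.\<close>

datatype cell_graph = Cell_Graph (rot: "nat list list") (opp: "nat \<Rightarrow> nat")

definition half_edges :: "cell_graph \<Rightarrow> nat set" where
  "half_edges G = set (concat (rot G))"

definition well_formed :: "cell_graph \<Rightarrow> bool" where
  "well_formed G \<longleftrightarrow> distinct (concat (rot G)) \<and>
     (\<forall>h\<in>half_edges G. opp G h \<in> half_edges G \<and> opp G h \<noteq> h \<and> opp G (opp G h) = h)"

definition adjacent :: "cell_graph \<Rightarrow> (nat \<times> nat) set" where
  "adjacent G = {(i, j). i < length (rot G) \<and> j < length (rot G) \<and>
     (\<exists>h\<in>set (rot G ! i). opp G h \<in> set (rot G ! j))}"

definition connected_graph :: "cell_graph \<Rightarrow> bool" where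
  "connected_graph G \<longleftrightarrow> rot G \<noteq> [] \<and>
     (\<forall>i < length (rot G). \<forall>j < length (rot G). (i, j) \<in> (adjacent G)\<^sup>*)"

definition edges :: "cell_graph \<Rightarrow> nat set set" where
  "edges G = (\<lambda>h. {h, opp G h}) ` half_edges G"

text \<open>The permutation of half-edges sending each one to its successor around its vertex.\<close>

definition vertex_perm :: "cell_graph \<Rightarrow> nat \<Rightarrow> nat" where
  "vertex_perm G = foldr (\<lambda>hs p. cycle_of_list hs \<circ> p) (rot G) id"

text \<open>A face is traced by crossing to the opposite half-edge and turning to its successor.  A vertex
  without half-edges is the sphere with a single 0-cell, which has one face not seen by this
  permutation.\<close>

definition num_faces :: "cell_graph \<Rightarrow> nat" where
  "num_faces G = card (orbit (vertex_perm G \<circ> opp G) ` half_edges G)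
     + length (filter (\<lambda>hs. hs = []) (rot G))"

definition cell_graphs :: "nat \<Rightarrow> nat \<Rightarrow> cell_graph set" where
  "cell_graphs g n = {G. well_formed G \<and> connected_graph G \<and> length (rot G) = n \<and>
     int n - int (card (edges G)) + int (num_faces G) = 2 - 2 * int g}"

definition cyc_eq :: "'b list \<Rightarrow> 'b list \<Rightarrow> bool" where
  "cyc_eq xs ys \<longleftrightarrow> (\<exists>k. rotate k xs = ys)"

definition graph_iso :: "cell_graph \<Rightarrow> cell_graph \<Rightarrow> bool" where
  "graph_iso G G' \<longleftrightarrow> length (rot G) = length (rot G') \<and>
     (\<exists>f. bij_betw f (half_edges G) (half_edges G') \<and>
          (\<forall>h\<in>half_edges G. f (opp G h) = opp G' (f h)) \<and>
          (\<forall>i < length (rot G). cyc_eq (map f (rot G ! i)) (rot G' ! i)))"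

definition iso_class :: "cell_graph \<Rightarrow> cell_graph set" where
  "iso_class G = {G'. graph_iso G G'}"

text \<open>Cell graphs of type \<open>(g, n)\<close> up to isomorphism.  Naming half-edges by natural numbers is no
  restriction, as they are finite in number.\<close>

definition Gamma :: "nat \<Rightarrow> nat \<Rightarrow> cell_graph set set" where
  "Gamma g n = iso_class ` cell_graphs g n"


section \<open>Edge contraction\<close>

definition remove_nth :: "nat \<Rightarrow> 'b list \<Rightarrow> 'b list" where
  "remove_nth j xs = take j xs @ drop (Suc j) xs"

definition replace_by_two :: "nat \<Rightarrow> 'b \<Rightarrow> 'b \<Rightarrow> 'b list \<Rightarrow> 'b list" where
  "replace_by_two i x y xs = take i xs @ [x, y] @ drop (Suc i) xs"

definition contracts_edge :: "cell_graph \<Rightarrow> nat \<Rightarrow> nat \<Rightarrow> cell_graph \<Rightarrow> bool" where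
  "contracts_edge G i j G' \<longleftrightarrow> i < j \<and> j < length (rot G) \<and>
     (\<exists>h as bs. cyc_eq (rot G ! i) (h # as) \<and> cyc_eq (rot G ! j) (opp G h # bs) \<and>
        G' = Cell_Graph (remove_nth j ((rot G)[i := as @ bs])) (opp G))"

text \<open>\<open>splits_vertex G i as bs\<close>: contracting some loop at \<open>i\<close> replaces \<open>i\<close> by two vertices with
  cyclic orders \<open>as\<close> and \<open>bs\<close>.  Either half of the loop may play the role of \<open>h\<close>, so the two new
  vertices may be labelled in either way.\<close>

definition splits_vertex :: "cell_graph \<Rightarrow> nat \<Rightarrow> nat list \<Rightarrow> nat list \<Rightarrow> bool" where
  "splits_vertex G i as bs \<longleftrightarrow> i < length (rot G) \<and>
     (\<exists>h. cyc_eq (rot G ! i) (h # as @ opp G h # bs))"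

definition contracts_loop :: "cell_graph \<Rightarrow> nat \<Rightarrow> cell_graph \<Rightarrow> bool" where
  "contracts_loop G i G' \<longleftrightarrow> (\<exists>as bs. splits_vertex G i as bs \<and>
     G' = Cell_Graph (replace_by_two i as bs (rot G)) (opp G))"

text \<open>The result of contracting a loop at \<open>i\<close> falls apart into \<open>G1\<close> and \<open>G2\<close>, whose old vertices are
  those of \<open>I\<close> and \<open>J\<close>; the new vertex of either part takes the place of \<open>i\<close> in the increasing
  order, which is what \<open>nths\<close> computes.  That there are no edges between the two parts is
  expressed by their being well-formed.\<close>

definition contracts_loop_disconnected ::
  "cell_graph \<Rightarrow> nat \<Rightarrow> nat set \<Rightarrow> nat set \<Rightarrow> cell_graph \<Rightarrow> cell_graph \<Rightarrow> bool" where
  "contracts_loop_disconnected G i I J G1 G2 \<longleftrightarrow>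
     I \<union> J = {..<length (rot G)} - {i} \<and> I \<inter> J = {} \<and>
     (\<exists>as bs. splits_vertex G i as bs \<and>
        G1 = Cell_Graph (nths ((rot G)[i := as]) (insert i I)) (opp G) \<and>
        G2 = Cell_Graph (nths ((rot G)[i := bs]) (insert i J)) (opp G) \<and>
        well_formed G1 \<and> well_formed G2)"


section \<open>Edge-contraction axioms\<close>

text \<open>An \<open>n\<close>-linear form on \<open>A\<close> is a function on lists of length \<open>n\<close>, and the axioms concern a map
  \<open>\<Omega>\<close> defined on isomorphism classes of cell graphs.\<close>

definition multilinear_form ::
  "('k::field \<Rightarrow> 'a::ab_group_add \<Rightarrow> 'a) \<Rightarrow> nat \<Rightarrow> ('a list \<Rightarrow> 'k) \<Rightarrow> bool" where
  "multilinear_form scale n F \<longleftrightarrow>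
     (\<forall>vs i. length vs = n \<longrightarrow> i < n \<longrightarrow> Vector_Spaces.linear scale (*) (\<lambda>x. F (vs[i := x])))"

definition ECA0 ::
  "('a::one \<Rightarrow> 'a \<Rightarrow> 'k::field) \<Rightarrow> (cell_graph set \<Rightarrow> 'a list \<Rightarrow> 'k) \<Rightarrow> bool" where
  "ECA0 \<eta> \<Omega> \<longleftrightarrow> (\<forall>v. \<Omega> (iso_class (Cell_Graph [[]] id)) [v] = counit \<eta> v)"

definition ECA1 :: "(cell_graph set \<Rightarrow> 'a::times list \<Rightarrow> 'k) \<Rightarrow> bool" where
  "ECA1 \<Omega> \<longleftrightarrow> (\<forall>g n i j. \<forall>G \<in> cell_graphs g n. \<forall>G' \<in> cell_graphs g (n - 1). \<forall>vs.
     contracts_edge G i j G' \<longrightarrow> length vs = n \<longrightarrow>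
     \<Omega> (iso_class G) vs = \<Omega> (iso_class G') (remove_nth j (vs[i := vs ! i * vs ! j])))"

definition ECA2_connected ::
  "'a::times set \<Rightarrow> ('a \<Rightarrow> 'a \<Rightarrow> 'k::field) \<Rightarrow> (cell_graph set \<Rightarrow> 'a list \<Rightarrow> 'k) \<Rightarrow> bool" where
  "ECA2_connected B \<eta> \<Omega> \<longleftrightarrow>
     (\<forall>g n i. \<forall>G \<in> cell_graphs g n. g \<ge> 1 \<longrightarrow> (\<forall>G' \<in> cell_graphs (g - 1) (n + 1). \<forall>vs.
       contracts_loop G i G' \<longrightarrow> length vs = n \<longrightarrow>
       \<Omega> (iso_class G) vs =
         (\<Sum>a\<in>B. \<Sum>b\<in>B. comult B \<eta> (vs ! i) a b * \<Omega> (iso_class G') (replace_by_two i a b vs))))"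

definition ECA2_disconnected ::
  "'a::times set \<Rightarrow> ('a \<Rightarrow> 'a \<Rightarrow> 'k::field) \<Rightarrow> (cell_graph set \<Rightarrow> 'a list \<Rightarrow> 'k) \<Rightarrow> bool" where
  "ECA2_disconnected B \<eta> \<Omega> \<longleftrightarrow>
     (\<forall>g n g1 g2 i I J. \<forall>G \<in> cell_graphs g n.
       \<forall>G1 \<in> cell_graphs g1 (card I + 1). \<forall>G2 \<in> cell_graphs g2 (card J + 1). \<forall>vs.
       contracts_loop_disconnected G i I J G1 G2 \<longrightarrow> g = g1 + g2 \<longrightarrow> length vs = n \<longrightarrow>
       \<Omega> (iso_class G) vs =
         (\<Sum>a\<in>B. \<Sum>b\<in>B. comult B \<eta> (vs ! i) a b *
            \<Omega> (iso_class G1) (nths (vs[i := a]) (insert i I)) *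
            \<Omega> (iso_class G2) (nths (vs[i := b]) (insert i J))))"

end

theory Submission
  imports Defs
begin

text \<open>Repeatedly contracting edges between distinct vertices leads to a graph with a single vertex,
  and contracting loops from there on to isolated points, where ECA 0 applies.  So induction on the
  number of half-edges gives \<open>\<epsilon>(v\<^sub>1 \<cdots> v\<^sub>n e\<^sup>g)\<close>: an edge leaves the product unchanged, a
  non-separating loop contributes \<open>m(\<delta>(v)) = v e\<close>, and for a separating loop the two factors
  recombine by \<open>(\<epsilon>(- x) \<otimes> \<epsilon>(- y)) (\<delta>(v)) = \<epsilon>(v x y)\<close>.

  That the contracted graphs have the right genus amounts to the invariance of the number of faces;
  the same induction shows that every connected graph has Euler characteristic \<open>2 - 2 g\<close> for some
  natural number \<open>g\<close>, which is needed to apply ECA 2 to the two parts.\<close>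

section \<open>The comultiplication of a Frobenius algebra\<close>

text \<open>The axioms apply only to graphs already known to lie in some
  \<open>cell_graphs g n\<close>, so connectedness and genus must be controlled together with the
  value of \<Omega>. For the pieces of a contracted loop neither the parity of the Euler
  characteristic nor its bound by 2 can be read off the rotations. The induction claim therefore
  asserts the existence of g alongside the formula: the isolated vertex has g = 0, an edge keeps g,
  a non-separating loop turns g into g + 1, and a separating one adds g1 and g2. That this g is the
  given genus follows at the very end, since the Euler characteristic determines it. Contracting
  loops only at the sole vertex of a graph keeps the index sets I and J of ECA 2 empty, so that old
  vertices never have to be distributed over two components.\<close>

lemma sum_swap_pairs:
  "(\<Sum>a\<in>A. \<Sum>b\<in>B. \<Sum>i\<in>I. \<Sum>j\<in>J. f a b i j) =
   (\<Sum>i\<in>I. \<Sum>j\<in>J. \<Sum>a\<in>A. \<Sum>b\<in>B. f a b i j)"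
proof -
  have "(\<Sum>a\<in>A. \<Sum>b\<in>B. \<Sum>i\<in>I. \<Sum>j\<in>J. f a b i j) =
      (\<Sum>a\<in>A. \<Sum>i\<in>I. \<Sum>b\<in>B. \<Sum>j\<in>J. f a b i j)"
    by (intro sum.cong refl sum.swap)
  also have "\<dots> = (\<Sum>i\<in>I. \<Sum>a\<in>A. \<Sum>j\<in>J. \<Sum>b\<in>B. f a b i j)"
    by (subst sum.swap) (intro sum.cong refl sum.swap)
  also have "\<dots> = (\<Sum>i\<in>I. \<Sum>j\<in>J. \<Sum>a\<in>A. \<Sum>b\<in>B. f a b i j)"
    by (intro sum.cong refl sum.swap)
  finally show ?thesis .
qed

context frobenius_algebra
begin

section \<open>Bilinearity of the form, the inverse Gram matrix and the dual basis\<close>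

lemma eta_add: "\<eta> x (y + z) = \<eta> x y + \<eta> x z"
  using eta_linear[of x] by (simp add: Vector_Spaces.linear_iff)

lemma eta_scale: "\<eta> x (scale c y) = c * \<eta> x y"
  using eta_linear[of x] by (simp add: Vector_Spaces.linear_iff)

lemma eta_sum: "\<eta> x (sum f S) = (\<Sum>i\<in>S. \<eta> x (f i))"
proof -
  have "\<eta> x 0 = 0" using eta_scale[of x 0 0] by simp
  then show ?thesis by (induction S rule: infinite_finite_induct) (auto simp: eta_add)
qed

lemma eta_sum_left: "\<eta> (sum f S) x = (\<Sum>i\<in>S. \<eta> (f i) x)"
  using eta_sum eta_sym by simp

lemma eta_scale_left: "\<eta> (scale c y) x = c * \<eta> y x"
  using eta_scale eta_sym by simp

lemma scale_mult_right: "x * scale c y = scale c (x * y)"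
  using scale_mult_left[of c y x] by (simp add: mult.commute)

text \<open>Non-degeneracy makes \<open>?T\<close> injective, hence surjective in finite dimension.
  The preimages of the basis vectors form the dual basis, and their coordinates are the rows of the
  inverse matrix. Existence is what gives the choice in \<open>gram_inv\<close> its meaning.\<close>

lemma ex_gram_inverse: "\<exists>M. is_gram_inverse Basis \<eta> M"
proof -
  let ?T = "\<lambda>x. \<Sum>b\<in>Basis. scale (\<eta> x b) b"
  interpret pair: finite_dimensional_vector_space_pair scale Basis scale Basis ..
  have add_left: "\<eta> (x + y) z = \<eta> x z + \<eta> y z" for x y z
    using eta_add eta_sym by simp
  have lin: "Vector_Spaces.linear scale scale ?T"
    using vector_space_axioms
    by (auto simp: Vector_Spaces.linear_iff add_left eta_scale_left scale_left_distrib
        sum.distrib scale_sum_right)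
  have indep: "c b = d b" if "(\<Sum>b\<in>Basis. scale (c b) b) = (\<Sum>b\<in>Basis. scale (d b) b)" "b \<in> Basis"
    for c d b
  proof -
    have "(\<Sum>b\<in>Basis. scale (c b - d b) b) = 0"
      using that(1) by (simp add: scale_left_diff_distrib sum_subtractf)
    then show ?thesis
      using independentD[OF independent_Basis finite_Basis order_refl _ that(2)] by force
  qed
  have "inj ?T"
  proof (rule injI)
    fix x y assume "?T x = ?T y"
    then have "\<eta> x b = \<eta> y b" if "b \<in> Basis" for b using indep that by blast
    then have b: "\<eta> (x - y) b = 0" if "b \<in> Basis" for b
      using that add_left[of "x - y" y b] by simp
    have "\<eta> (x - y) z = 0" for z
    proof -
      have "\<eta> (x - y) z = \<eta> (x - y) (\<Sum>c\<in>Basis. scale (representation Basis z c) c)"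
        using sum_representation_eq[OF independent_Basis _ finite_Basis, of z] span_Basis by simp
      then show ?thesis using b by (simp add: eta_sum eta_scale)
    qed
    then show "x = y" using eta_nondegenerate[of "x - y"] by simp
  qed
  then have "surj ?T" using pair.linear_injective_imp_surjective[OF lin] by simp
  then have "?T (inv ?T b) = b" for b by (rule surj_f_inv_f)
  then obtain d where d: "?T (d b) = b" for b by blast
  define M where "M b = representation Basis (d b)" for b
  have eta_d: "\<eta> (d b) c = (if b = c then 1 else 0)" if "b \<in> Basis" "c \<in> Basis" for b c
  proof -
    have "?T (d b) = (\<Sum>c\<in>Basis. if c = b then scale 1 c else 0)"
      using that d by (simp add: finite_Basis)
    also have "\<dots> = (\<Sum>c\<in>Basis. scale (if b = c then 1 else 0) c)"
      by (intro sum.cong) auto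
    finally show ?thesis using indep[of "\<eta> (d b)" "\<lambda>c. if b = c then 1 else 0" c] that by simp
  qed
  have M: "d b = (\<Sum>c\<in>Basis. scale (M b c) c)" for b
    using sum_representation_eq[OF independent_Basis _ finite_Basis, of "d b"] span_Basis
    by (simp add: M_def)
  have inv: "(\<Sum>z\<in>Basis. M x z * \<eta> z y) = (if x = y then 1 else 0)"
    if "x \<in> Basis" "y \<in> Basis" for x y
    using eta_d[OF that] by (subst (asm) M) (simp add: eta_sum_left eta_scale_left)
  \<comment> \<open>By the symmetry of \<eta> this value is also \<open>M b c\<close> on the basis.
    So \<open>M\<close> is symmetric, and the left inverse is a right inverse too.\<close>
  have eta_dd: "\<eta> (d b) (d c) = M c b" if "b \<in> Basis" for b c
  proof -
    have "\<eta> (d b) (d c) = (\<Sum>z\<in>Basis. M c z * \<eta> (d b) z)"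
      by (subst (2) M) (simp add: eta_sum eta_scale)
    also have "\<dots> = (\<Sum>z\<in>Basis. if z = b then M c z else 0)"
      using eta_d that by (intro sum.cong) auto
    also have "\<dots> = M c b" using that by (simp add: finite_Basis)
    finally show ?thesis .
  qed
  have "(\<Sum>z\<in>Basis. \<eta> x z * M z y) = (if x = y then 1 else 0)"
    if "x \<in> Basis" "y \<in> Basis" for x y
  proof -
    have "(\<Sum>z\<in>Basis. \<eta> x z * M z y) = (\<Sum>z\<in>Basis. M y z * \<eta> z x)"
      using eta_dd that by (intro sum.cong refl) (metis eta_sym mult.commute)
    then show ?thesis using inv[OF that(2,1)] by auto
  qed
  then have "is_gram_inverse Basis \<eta> M" using inv by (simp add: is_gram_inverse_def)
  then show ?thesis by blast
qed

lemma gram_inv: "is_gram_inverse Basis \<eta> (gram_inv Basis \<eta>)"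
  unfolding gram_inv_def using ex_gram_inverse by (rule someI_ex)

text \<open>For a basis vector i this is the dual basis vector: pairing it with a basis vector j
  gives 1 if i = j and 0 otherwise. In these terms \<delta>(v) is the sum of \<eta>(v, ij) times
  \<open>dual i\<close> \<otimes> \<open>dual j\<close>.\<close>

definition dual :: "'a \<Rightarrow> 'a" where
  "dual i = (\<Sum>a\<in>Basis. scale (gram_inv Basis \<eta> i a) a)"

text \<open>Expansion of x in the dual basis. The identities for \<delta> below reach the inverse
  matrix through this relation.\<close>

lemma sum_eta_dual: "(\<Sum>j\<in>Basis. scale (\<eta> x j) (dual j)) = x"
proof -
  let ?M = "gram_inv Basis \<eta>" and ?r = "representation Basis x"
  have x: "x = (\<Sum>c\<in>Basis. scale (?r c) c)"
    using sum_representation_eq[OF independent_Basis _ finite_Basis, of x] span_Basis by simp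
  have e: "\<eta> x j = (\<Sum>c\<in>Basis. ?r c * \<eta> c j)" for j
    by (subst x) (simp add: eta_sum_left eta_scale_left)
  have "(\<Sum>j\<in>Basis. scale (\<eta> x j) (dual j)) =
    (\<Sum>j\<in>Basis. \<Sum>a\<in>Basis. \<Sum>c\<in>Basis. scale (?r c * (\<eta> c j * ?M j a)) a)"
    by (simp add: dual_def scale_sum_right e sum_distrib_right scale_sum_left mult.assoc)
  also have "\<dots> = (\<Sum>a\<in>Basis. \<Sum>j\<in>Basis. \<Sum>c\<in>Basis. scale (?r c * (\<eta> c j * ?M j a)) a)"
    by (rule sum.swap)
  also have "\<dots> = (\<Sum>a\<in>Basis. \<Sum>c\<in>Basis. \<Sum>j\<in>Basis. scale (?r c * (\<eta> c j * ?M j a)) a)"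
    by (intro sum.cong refl sum.swap)
  also have "\<dots> = (\<Sum>a\<in>Basis. \<Sum>c\<in>Basis. scale (?r c * (\<Sum>j\<in>Basis. \<eta> c j * ?M j a)) a)"
    by (simp add: scale_sum_left sum_distrib_left)
  also have "\<dots> = (\<Sum>a\<in>Basis. \<Sum>c\<in>Basis. if c = a then scale (?r a) a else 0)"
    using gram_inv by (intro sum.cong refl) (auto simp: is_gram_inverse_def)
  also have "\<dots> = (\<Sum>a\<in>Basis. scale (?r a) a)"
    by (intro sum.cong refl) (simp add: finite_Basis)
  also have "\<dots> = x" using x by simp
  finally show ?thesis .
qed

text \<open>This is F \<otimes> H evaluated on \<delta>(v). For linear F and H the inner sums are
  F(\<open>dual i\<close>) and H(\<open>dual j\<close>).\<close>

lemma sum_comult_mult: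
  "(\<Sum>a\<in>Basis. \<Sum>b\<in>Basis. comult Basis \<eta> v a b * F a * H b) =
   (\<Sum>i\<in>Basis. \<Sum>j\<in>Basis. \<eta> v (i * j) * (\<Sum>a\<in>Basis. gram_inv Basis \<eta> i a * F a)
      * (\<Sum>b\<in>Basis. gram_inv Basis \<eta> j b * H b))"
  (is "_ = ?rhs")
proof -
  let ?M = "gram_inv Basis \<eta>"
  have "(\<Sum>a\<in>Basis. \<Sum>b\<in>Basis. comult Basis \<eta> v a b * F a * H b) =
    (\<Sum>a\<in>Basis. \<Sum>b\<in>Basis. \<Sum>i\<in>Basis. \<Sum>j\<in>Basis.
      \<eta> v (i * j) * ?M i a * ?M j b * F a * H b)"
    by (simp add: comult_def sum_distrib_right)
  also have "\<dots> = (\<Sum>i\<in>Basis. \<Sum>j\<in>Basis. \<Sum>a\<in>Basis. \<Sum>b\<in>Basis.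
      \<eta> v (i * j) * ?M i a * ?M j b * F a * H b)"
    by (rule sum_swap_pairs)
  also have "\<dots> = ?rhs"
    by (intro sum.cong refl) (simp only: mult.assoc sum_product, simp add: sum_distrib_left ac_simps)
  finally show ?thesis .
qed

lemma comult_counit_counit:
  "(\<Sum>a\<in>Basis. \<Sum>b\<in>Basis. comult Basis \<eta> v a b * counit \<eta> (a * x) * counit \<eta> (b * y)) =
   counit \<eta> (v * (x * y))"
proof -
  have c: "counit \<eta> (a * z) = \<eta> a z" for a z
    by (simp add: counit_def eta_mult)
  have d: "(\<Sum>a\<in>Basis. gram_inv Basis \<eta> i a * \<eta> a z) = \<eta> (dual i) z" for i z
    by (simp add: dual_def eta_sum_left eta_scale_left)
  \<comment> \<open>The dual-basis expansion of u paired with z. It collapses the sum over j with u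
    = vi, and then the sum over i with u = vy.\<close>
  have in1: "(\<Sum>j\<in>Basis. \<eta> u j * \<eta> (dual j) z) = \<eta> u z" for u z
    by (subst (3) sum_eta_dual[symmetric]) (simp add: eta_sum_left eta_scale_left)
  have "(\<Sum>a\<in>Basis. \<Sum>b\<in>Basis. comult Basis \<eta> v a b * counit \<eta> (a * x) * counit \<eta> (b * y)) =
    (\<Sum>i\<in>Basis. \<Sum>j\<in>Basis. \<eta> v (i * j) * \<eta> (dual i) x * \<eta> (dual j) y)"
    by (simp add: sum_comult_mult c d)
  also have "\<dots> = (\<Sum>i\<in>Basis. \<eta> (dual i) x * (\<Sum>j\<in>Basis. \<eta> (v * i) j * \<eta> (dual j) y))"
    by (simp add: sum_distrib_left eta_mult ac_simps)
  also have "\<dots> = (\<Sum>i\<in>Basis. \<eta> (v * y) i * \<eta> (dual i) x)"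
  proof (intro sum.cong refl)
    fix i
    have "\<eta> (v * i) y = \<eta> (v * y) i" by (metis eta_mult mult.commute)
    then show "\<eta> (dual i) x * (\<Sum>j\<in>Basis. \<eta> (v * i) j * \<eta> (dual j) y) =
        \<eta> (v * y) i * \<eta> (dual i) x"
      by (simp add: in1 mult.commute)
  qed
  also have "\<dots> = counit \<eta> (v * (x * y))"
    unfolding in1 by (metis c eta_mult mult.commute mult.assoc counit_def)
  finally show ?thesis .
qed

text \<open>By invariance of the form, \<eta>(v, ij) = \<eta>(vi, j), and the sum over j is the
  dual-basis expansion of vi. Thus m(\<delta>(v)) is v times a fixed element, which for v = 1 is the
  Euler element.\<close>

lemma comult_mult:
  "(\<Sum>a\<in>Basis. \<Sum>b\<in>Basis. scale (comult Basis \<eta> v a b) (a * b)) =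
   v * (\<Sum>i\<in>Basis. dual i * i)"
proof -
  let ?M = "gram_inv Basis \<eta>"
  have "(\<Sum>a\<in>Basis. \<Sum>b\<in>Basis. scale (comult Basis \<eta> v a b) (a * b)) =
    (\<Sum>a\<in>Basis. \<Sum>b\<in>Basis. \<Sum>i\<in>Basis. \<Sum>j\<in>Basis.
      scale (\<eta> v (i * j) * ?M i a * ?M j b) (a * b))"
    by (simp add: comult_def scale_sum_left)
  also have "\<dots> = (\<Sum>i\<in>Basis. \<Sum>j\<in>Basis. \<Sum>a\<in>Basis. \<Sum>b\<in>Basis.
      scale (\<eta> v (i * j) * ?M i a * ?M j b) (a * b))"
    by (rule sum_swap_pairs)
  also have "\<dots> = (\<Sum>i\<in>Basis. \<Sum>j\<in>Basis. scale (\<eta> v (i * j)) (dual i * dual j))"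
    by (intro sum.cong refl)
      (simp add: dual_def sum_product scale_sum_right scale_mult_left scale_mult_right ac_simps)
  also have "\<dots> = (\<Sum>i\<in>Basis. dual i * (\<Sum>j\<in>Basis. scale (\<eta> (v * i) j) (dual j)))"
    by (simp add: sum_distrib_left scale_mult_right eta_mult)
  also have "\<dots> = v * (\<Sum>i\<in>Basis. dual i * i)"
    by (simp add: sum_eta_dual sum_distrib_left mult.left_commute)
  finally show ?thesis .
qed

text \<open>The identity \<open>comult_mult\<close> is used at v and, inside the definition of the
  Euler element, at 1. The factor x will be the power of the Euler element left over from the
  smaller genus.\<close>

lemma comult_counit_euler:
  "(\<Sum>a\<in>Basis. \<Sum>b\<in>Basis. comult Basis \<eta> v a b * counit \<eta> (a * b * x)) =
   counit \<eta> (v * (euler_element scale Basis \<eta> * x))"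
proof -
  have c: "counit \<eta> (a * z) = \<eta> a z" for a z
    by (simp add: counit_def eta_mult)
  have "(\<Sum>a\<in>Basis. \<Sum>b\<in>Basis. comult Basis \<eta> v a b * counit \<eta> (a * b * x)) =
    \<eta> (\<Sum>a\<in>Basis. \<Sum>b\<in>Basis. scale (comult Basis \<eta> v a b) (a * b)) x"
    by (simp add: c eta_sum_left eta_scale_left)
  also have "\<dots> = \<eta> (v * euler_element scale Basis \<eta>) x"
    unfolding euler_element_def comult_mult by simp
  finally show ?thesis by (metis c mult.assoc)
qed
end

section \<open>Counting orbits\<close>

text \<open>The permutation induced on the complement of \<open>z\<close>, that is, the first-return map.\<close>

definition skip :: "'a \<Rightarrow> ('a \<Rightarrow> 'a) \<Rightarrow> 'a \<Rightarrow> 'a" where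
  "skip z p x = (if p x = z then p z else p x)"

lemma bij_betw_skip:
  assumes "bij_betw p H H" "z \<in> H"
  shows "bij_betw (skip z p) (H - {z}) (H - {z})"
proof (rule bij_betwI')
  have inj: "p x = p y \<longleftrightarrow> x = y" if "x \<in> H" "y \<in> H" for x y
    using assms(1) that by (auto simp: bij_betw_def inj_on_def)
  have H: "p x \<in> H" if "x \<in> H" for x
    using assms(1) that by (auto simp: bij_betw_def)
  show "(skip z p x = skip z p y) = (x = y)" if "x \<in> H - {z}" "y \<in> H - {z}" for x y
    using that inj[of x y] inj[of x z] inj[of y z] assms(2) by (auto simp: skip_def)
  show "skip z p x \<in> H - {z}" if "x \<in> H - {z}" for x
    using that inj[of x z] H assms(2) by (auto simp: skip_def)
  show "\<exists>x\<in>H - {z}. y = skip z p x" if y: "y \<in> H - {z}" for y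
  proof -
    have "y \<in> p ` H" "z \<in> p ` H" using assms y by (simp_all add: bij_betw_def)
    then obtain x w where x: "x \<in> H" "p x = y" and w: "w \<in> H" "p w = z" by blast
    show ?thesis
    \<comment> \<open>If y is the image of z itself, the first-return map reaches it from the
      predecessor w of z.\<close>
    proof (cases "x = z")
      case True
      then show ?thesis using x w y by (intro bexI[of _ w]) (auto simp: skip_def)
    next
      case False
      then show ?thesis using x y by (intro bexI[of _ x]) (auto simp: skip_def)
    qed
  qed
qed

text \<open>An \<open>orbit\<close> starts with p x, so x belongs to it only because p eventually
  returns. As p is bijective on H only, it is extended by the identity to a permutation of the whole
  type.\<close>

lemma bij_betw_self_in_orbit:
  assumes "finite H" "bij_betw p H H" "x \<in> H"
  shows "x \<in> orbit p x"
proof -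
  let ?q = "\<lambda>x. if x \<in> H then p x else x"
  have "bij_betw ?q H H" using assms(2) by (simp cong: bij_betw_cong)
  then have "?q permutes H" by (rule bij_imp_permutes) simp
  then have "permutation ?q" using assms(1) unfolding permutation_permutes by (intro exI conjI)
  then have "x \<in> orbit ?q x" by (rule permutation_self_in_orbit)
  also have "orbit ?q x = orbit p x"
    by (rule sym, rule orbit_cong0[of _ H]) (use assms in \<open>auto simp: bij_betw_def\<close>)
  finally show ?thesis .
qed

lemma orbit_eq_if_mem:
  assumes "finite H" "bij_betw p H H" "x \<in> H" "y \<in> orbit p x"
  shows "orbit p y = orbit p x"
proof
  show "orbit p y \<subseteq> orbit p x" using assms(4) by (auto intro: orbit_trans)
  have "x \<in> orbit p y" by (rule orbit_swap[OF bij_betw_self_in_orbit[OF assms(1-3)] assms(4)])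
  then show "orbit p x \<subseteq> orbit p y" by (auto intro: orbit_trans)
qed

lemma orbit_skip:
  assumes "inj_on p H" "p ` H \<subseteq> H" "z \<in> H" "p z \<noteq> z" "x \<in> H" "x \<noteq> z"
  shows "orbit (skip z p) x = orbit p x - {z}"
proof (intro equalityI subsetI)
  fix y assume "y \<in> orbit (skip z p) x"
  then have "y \<in> orbit p x \<and> y \<in> H \<and> y \<noteq> z"
  proof induction
    case base
    have "p x \<in> orbit p x" "p (p x) \<in> orbit p x" by (auto intro: orbit.intros)
    then show ?case using assms by (auto simp: skip_def inj_on_def split: if_splits)
  next
    case (step y)
    then have "p y \<in> orbit p x" "p (p y) \<in> orbit p x" by (auto intro: orbit.intros)
    then show ?case using assms step by (auto simp: skip_def inj_on_def split: if_splits)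
  qed
  then show "y \<in> orbit p x - {z}" by auto
next
  fix y assume y: "y \<in> orbit p x - {z}"
  then have "y \<in> orbit p x" by simp
  \<comment> \<open>The orbit of p may pass through z, which the first-return map jumps over. The
    second conjunct carries the induction across that point.\<close>
  then have "(y \<noteq> z \<longrightarrow> y \<in> orbit (skip z p) x) \<and> (y = z \<longrightarrow> p z \<in> orbit (skip z p) x)"
  proof induction
    case base
    have "skip z p x \<in> orbit (skip z p) x" by (rule orbit.base)
    then show ?case by (auto simp: skip_def[of z p x])
  next
    case (step y)
    show ?case
    proof (cases "y = z")
      case True then show ?thesis using step assms(4) by auto
    next
      case False
      then have "skip z p y \<in> orbit (skip z p) x" using step by (auto intro: orbit.step)
      then show ?thesis by (auto simp: skip_def[of z p y] split: if_splits)
    qed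
  qed
  then show "y \<in> orbit (skip z p) x" using y by auto
qed

text \<open>A fixed point z takes its orbit {z} with it. Otherwise the orbit of z contains p z as
  well and merely shrinks, so no orbit disappears.\<close>

lemma card_orbits_skip:
  assumes "finite H" "bij_betw p H H" "z \<in> H"
  shows "card (orbit p ` H) = card (orbit (skip z p) ` (H - {z})) + (if p z = z then 1 else 0)"
proof (cases "p z = z")
  case True
  have fx: "p x = z \<longleftrightarrow> x = z" if "x \<in> H" for x
    using assms that True by (metis bij_betw_def inj_on_def)
  have H: "p x \<in> H" if "x \<in> H" for x
    using assms(2) that by (auto simp: bij_betw_def)
  have eq: "orbit p x = orbit (skip z p) x" if "x \<in> H - {z}" for x
    by (rule orbit_cong0[of _ "H - {z}"]) (use that fx H in \<open>auto simp: skip_def\<close>)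
  have z: "orbit p z = {z}" using True by (simp add: orbit_eq_singleton_iff)
  have "orbit p z \<notin> orbit p ` (H - {z})"
    using bij_betw_self_in_orbit[OF assms(1,2)] z by auto
  moreover have "orbit p ` H = insert (orbit p z) (orbit p ` (H - {z}))"
    using assms(3) by auto
  ultimately have "card (orbit p ` H) = Suc (card (orbit p ` (H - {z})))"
    using assms(1) by simp
  moreover have "orbit p ` (H - {z}) = orbit (skip z p) ` (H - {z})"
    using eq by (intro image_cong) auto
  ultimately show ?thesis using True by simp
next
  case False
  have pz: "p z \<in> H - {z}" using assms False by (auto simp: bij_betw_def)
  have sk: "orbit (skip z p) x = orbit p x - {z}" if "x \<in> H - {z}" for x
    by (rule orbit_skip[of p H]) (use assms False that in \<open>auto simp: bij_betw_def\<close>)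
  have "orbit p z = orbit p (p z)"
    using orbit_eq_if_mem[OF assms orbit.base] by simp
  then have H: "orbit p ` H = orbit p ` (H - {z})"
    using pz assms(3) by auto
  \<comment> \<open>Each orbit here has a starting point other than z. This point survives the
    removal of z and identifies the orbit.\<close>
  have "inj_on (\<lambda>Q. Q - {z}) (orbit p ` (H - {z}))"
  proof (rule inj_onI)
    fix P Q assume PQ: "P \<in> orbit p ` (H - {z})" "Q \<in> orbit p ` (H - {z})" "P - {z} = Q - {z}"
    then obtain x y where xy: "x \<in> H - {z}" "P = orbit p x" "y \<in> H - {z}" "Q = orbit p y" by blast
    then have "x \<in> orbit p y"
      using bij_betw_self_in_orbit[OF assms(1,2), of x] PQ(3) by auto
    then show "P = Q" using orbit_eq_if_mem[OF assms(1,2)] xy by blast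
  qed
  then have "card ((\<lambda>Q. Q - {z}) ` orbit p ` (H - {z})) = card (orbit p ` (H - {z}))"
    by (rule card_image)
  moreover have "(\<lambda>Q. Q - {z}) ` orbit p ` (H - {z}) = orbit (skip z p) ` (H - {z})"
    unfolding image_image using sk by (intro image_cong) auto
  ultimately show ?thesis using False H by simp
qed

section \<open>Faces under contraction\<close>

lemma cycle_of_list_Cons_hd:
  "distinct (h # as) \<Longrightarrow> cycle_of_list (h # as) h = hd (as @ [h])"
  by (cases as) (auto simp: id_outside_supp)

lemma cycle_of_list_in_set_iff: "cycle_of_list xs x \<in> set xs \<longleftrightarrow> x \<in> set xs"
  using cycle_permutes permutes_in_image by metis

lemma cycle_of_list_append_commute:
  "distinct (xs @ ys) \<Longrightarrow> cycle_of_list (xs @ ys) = cycle_of_list (ys @ xs)"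
  by (metis cycle_of_list_rotate_independent rotate_append)

text \<open>Deleting an entry of a cycle yields its first-return map. Rotating z to the front
  reduces this to the recursion of \<open>cycle_of_list\<close>, which puts one transposition in
  front of the shorter cycle.\<close>

lemma cycle_of_list_remove:
  assumes "distinct (xs @ z # ys)" "x \<noteq> z"
  shows "cycle_of_list (xs @ ys) x = skip z (cycle_of_list (xs @ z # ys)) x"
proof -
  have 1: "cycle_of_list zs x = skip z (cycle_of_list (z # zs)) x" if "z \<notin> set zs" for zs
  proof (cases zs)
    case Nil
    then show ?thesis using assms(2) by (simp add: skip_def)
  next
    case (Cons y ys')
    have "cycle_of_list (y # ys') x \<noteq> z"
      using Cons that assms(2) by (metis cycle_of_list_in_set_iff id_outside_supp)
    moreover have "cycle_of_list (y # ys') z = z" using Cons that by (simp add: id_outside_supp)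
    ultimately show ?thesis using Cons by (auto simp: skip_def transpose_def)
  qed
  have "cycle_of_list (xs @ ys) = cycle_of_list (ys @ xs)"
    by (rule cycle_of_list_append_commute) (use assms in auto)
  moreover have "cycle_of_list (xs @ z # ys) = cycle_of_list (z # ys @ xs)"
    using cycle_of_list_append_commute[OF assms(1)] by simp
  ultimately show ?thesis using 1[of "ys @ xs"] assms by auto
qed

text \<open>A transposition of points in two disjoint cycles joins the cycles; multiplied once more,
  it separates them. The induction moves it past the transposition of h and a by
  conjugation.\<close>

lemma cycle_of_list_merge:
  assumes "distinct (h # as @ k # bs)"
  shows "cycle_of_list (h # as @ k # bs) =
    transpose h k \<circ> (cycle_of_list (h # as) \<circ> cycle_of_list (k # bs))"
  using assms
proof (induction as arbitrary: h)
  case Nil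
  then show ?case by simp
next
  case (Cons a as)
  have "cycle_of_list (h # (a # as) @ k # bs) = transpose h a \<circ> cycle_of_list (a # as @ k # bs)"
    by simp
  also have "cycle_of_list (a # as @ k # bs) =
      transpose a k \<circ> (cycle_of_list (a # as) \<circ> cycle_of_list (k # bs))"
    by (rule Cons.IH) (use Cons.prems in auto)
  also have "transpose h a \<circ> \<dots> =
      (transpose h a \<circ> transpose a k) \<circ> (cycle_of_list (a # as) \<circ> cycle_of_list (k # bs))"
    by (simp only: comp_assoc)
  also have "transpose h a \<circ> transpose a k = transpose h k \<circ> transpose h a"
    using Cons.prems by (auto simp: fun_eq_iff transpose_def)
  finally show ?case by (simp add: comp_assoc)
qed

lemma cyc_eq_imp:
  assumes "cyc_eq xs ys"
  shows "set xs = set ys" "distinct xs = distinct ys"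
    "distinct xs \<Longrightarrow> cycle_of_list xs = cycle_of_list ys"
  using assms cycle_of_list_rotate_independent by (auto simp: cyc_eq_def)

section \<open>Vertex permutations as products of disjoint cycles\<close>

definition cycles_perm :: "'a list list \<Rightarrow> 'a \<Rightarrow> 'a" where
  "cycles_perm R = foldr (\<lambda>hs p. cycle_of_list hs \<circ> p) R id"

lemma cycles_perm_simps [simp]:
  "cycles_perm [] = id"
  "cycles_perm (hs # R) = cycle_of_list hs \<circ> cycles_perm R"
  by (simp_all add: cycles_perm_def)

lemma vertex_perm_eq: "vertex_perm G = cycles_perm (rot G)"
  by (simp add: vertex_perm_def cycles_perm_def)

lemma cycles_perm_outside: "x \<notin> set (concat R) \<Longrightarrow> cycles_perm R x = x"
  by (induction R) (auto simp: id_outside_supp)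

lemma cycles_perm_apply:
  assumes "distinct (concat R)" "hs \<in> set R" "x \<in> set hs"
  shows "cycles_perm R x = cycle_of_list hs x"
  using assms(1,2)
proof (induction R)
  case (Cons a R)
  show ?case
  proof (cases "x \<in> set a")
    case True
    then have "x \<notin> set (concat R)" using Cons.prems by auto
    moreover from this have "hs = a" using Cons.prems assms(3) by auto
    ultimately show ?thesis using cycles_perm_outside[of x R] by simp
  next
    case False
    then have "hs \<in> set R" using Cons.prems assms(3) by auto
    then have "cycles_perm R x = cycle_of_list hs x"
      using Cons by simp
    moreover have "cycle_of_list hs x \<notin> set a"
      using \<open>hs \<in> set R\<close> Cons.prems assms(3) cycle_of_list_in_set_iff[of hs x] by auto
    ultimately show ?thesis by (simp add: id_outside_supp)
  qed
qed simp

lemma cycles_perm_permutes: "cycles_perm R permutes set (concat R)"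
proof (induction R)
  case (Cons a R)
  have "cycles_perm R permutes set (concat (a # R))"
    by (rule permutes_subset[OF Cons]) auto
  moreover have "cycle_of_list a permutes set (concat (a # R))"
    by (rule permutes_subset[OF cycle_permutes]) auto
  ultimately have "cycle_of_list a \<circ> cycles_perm R permutes set (concat (a # R))"
    by (rule permutes_compose)
  then show ?case by (simp only: cycles_perm_simps)
qed (simp only: cycles_perm_simps concat.simps list.set permutes_id)

lemma bij_betw_vertex_perm: "bij_betw (vertex_perm G) (half_edges G) (half_edges G)"
  by (simp only: vertex_perm_eq half_edges_def cycles_perm_permutes permutes_imp_bij)

lemma bij_betw_opp: "well_formed G \<Longrightarrow> bij_betw (opp G) (half_edges G) (half_edges G)"
  by (rule bij_betw_byWitness[of _ "opp G"]) (auto simp: well_formed_def)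

lemma finite_half_edges [simp]: "finite (half_edges G)"
  by (simp add: half_edges_def)

text \<open>Both kinds of contraction replace the vertex permutation \<open>s\<close> by the first-return map of
  \<open>transpose h k \<circ> s\<close>; the face permutation is then replaced by its own first-return map.  A face
  is lost to the permutation exactly if all its half-edges are among \<open>h, k\<close>; the premise on empty
  rotations says that each such face becomes that of an isolated vertex.\<close>

lemma num_faces_contract:
  fixes G G' h
  defines "k \<equiv> opp G h" and "s \<equiv> vertex_perm G"
  assumes wf: "well_formed G" and h: "h \<in> half_edges G"
    and opp: "opp G' = opp G" and H': "half_edges G' = half_edges G - {h, k}"
    and s': "\<And>x. x \<in> half_edges G' \<Longrightarrow>
      vertex_perm G' x = skip k (skip h (transpose h k \<circ> s)) x"
    and new: "length (filter (\<lambda>hs. hs = []) (rot G')) = length (filter (\<lambda>hs. hs = []) (rot G)) +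
      (if s k = h then 1 else 0) + (if s h = k \<or> s h = h \<and> s k = k then 1 else 0)"
  shows "num_faces G' = num_faces G"
proof -
  let ?H = "half_edges G" and ?f = "vertex_perm G \<circ> opp G"
  have k: "k \<in> ?H" "k \<noteq> h" "opp G k = h" "opp G h = k"
    using wf h by (auto simp: well_formed_def k_def)
  have bf: "bij_betw ?f ?H ?H"
    using bij_betw_trans[OF bij_betw_opp[OF wf] bij_betw_vertex_perm] .
  have bsk: "bij_betw (skip h ?f) (?H - {h}) (?H - {h})" by (rule bij_betw_skip[OF bf h])
  have inj: "s x = s y \<longleftrightarrow> x = y" if "x \<in> ?H" "y \<in> ?H" for x y
    using bij_betw_vertex_perm[of G] that by (auto simp: bij_betw_def inj_on_def s_def)
  have H2: "?H - {h} - {k} = half_edges G'" using H' by auto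
  have "orbit (vertex_perm G' \<circ> opp G') x = orbit (skip k (skip h ?f)) x" if "x \<in> half_edges G'" for x
  proof (rule sym, rule orbit_cong0[OF that])
    have "bij_betw (skip k (skip h ?f)) (half_edges G') (half_edges G')"
      using bij_betw_skip[OF bsk, of k] k by (simp only: H2) auto
    then show "skip k (skip h ?f) \<in> half_edges G' \<rightarrow> half_edges G'"
      by (auto simp: bij_betw_def)
    fix x assume x: "x \<in> half_edges G'"
    then have x': "x \<in> ?H" "x \<noteq> h" "x \<noteq> k" using H' by auto
    define y where "y = opp G x"
    have y: "y \<in> ?H" "y \<noteq> h" "y \<noteq> k" using x' wf k by (auto simp: well_formed_def y_def)
    then have "vertex_perm G' y = skip k (skip h (transpose h k \<circ> s)) y"
      using s' H' by auto
    \<comment> \<open>A face path arriving at h crosses to k and goes on with s k. The transposition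
      sends a vertex path arriving at h to k, so it goes on with s k too; likewise with h and k
      exchanged.\<close>
    moreover have "skip k (skip h ?f) x = skip k (skip h (transpose h k \<circ> s)) y"
    proof -
      have f: "?f x = s y" "?f h = s k" "?f k = s h"
        using k by (simp_all add: s_def y_def)
      have ne: "s y \<noteq> s h" "s y \<noteq> s k" "s h \<noteq> s k"
        using y k h inj by auto
      consider "s y = h" | "s y = k" | "s y \<noteq> h" "s y \<noteq> k" by blast
      then show ?thesis
      proof cases
        case 1
        then show ?thesis using ne k(2) unfolding skip_def f by (auto simp: transpose_def)
      next
        case 2
        then show ?thesis using ne k(2) unfolding skip_def f by (auto simp: transpose_def)
      next
        case 3
        then show ?thesis unfolding skip_def f by (simp add: transpose_def)
      qed
    qed
    ultimately show "skip k (skip h ?f) x = (vertex_perm G' \<circ> opp G') x"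
      by (simp add: opp y_def)
  qed
  then have "orbit (vertex_perm G' \<circ> opp G') ` half_edges G' =
      orbit (skip k (skip h ?f)) ` half_edges G'" by (intro image_cong) auto
  moreover have "card (orbit ?f ` ?H) = card (orbit (skip k (skip h ?f)) ` half_edges G')
      + (if ?f h = h then 1 else 0) + (if skip h ?f k = k then 1 else 0)"
    using card_orbits_skip[OF _ bf h] card_orbits_skip[OF _ bsk, of k] k H2 by simp
  moreover have "?f h = h \<longleftrightarrow> s k = h" using k by (simp add: s_def)
  \<comment> \<open>After the removal of h, the point k is fixed in two cases: its face was {k}, or
    h and k formed a face by themselves.\<close>
  moreover have "skip h ?f k = k \<longleftrightarrow> s h = k \<or> s h = h \<and> s k = k"
    using k by (auto simp: skip_def s_def)
  ultimately show ?thesis using new unfolding num_faces_def by simp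
qed

section \<open>List surgery for contractions, products of labels, and the edge count\<close>

lemma remove_nth_append [simp]:
  "length xs = j \<Longrightarrow> remove_nth j (xs @ y # ys) = xs @ ys"
  by (auto simp: remove_nth_def)

lemma split_list_two:
  assumes "i < j" "j < length R"
  obtains X Y Z where "R = X @ R ! i # Y @ R ! j # Z" "length X = i" "length X + length Y + 1 = j"
proof
  let ?X = "take i R" and ?Y = "take (j - i - 1) (drop (Suc i) R)" and ?Z = "drop (Suc j) R"
  have "drop (Suc i) R = ?Y @ drop (Suc i) R ! (j - i - 1) # drop (Suc (j - i - 1)) (drop (Suc i) R)"
    by (rule id_take_nth_drop) (use assms in auto)
  moreover have "drop (Suc i) R ! (j - i - 1) = R ! j" "drop (Suc (j - i - 1)) (drop (Suc i) R) = ?Z"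
    using assms by auto
  ultimately have "drop (Suc i) R = ?Y @ R ! j # ?Z" by metis
  then show "R = ?X @ R ! i # ?Y @ R ! j # ?Z"
    using id_take_nth_drop[of i R] assms by auto
  show "length ?X = i" "length ?X + length ?Y + 1 = j" using assms by auto
qed

lemma prod_list_remove_nth_mult:
  fixes vs :: "'a::comm_monoid_mult list"
  assumes "i < j" "j < length vs"
  shows "prod_list (remove_nth j (vs[i := vs ! i * vs ! j])) = prod_list vs"
proof -
  obtain X Y Z where "vs = X @ vs ! i # Y @ vs ! j # Z" "length X = i" "length X + length Y + 1 = j"
    using split_list_two[OF assms] .
  then obtain a b where v: "vs = X @ a # Y @ b # Z" "length X = i" "i + length Y + 1 = j" by blast
  have e: "vs ! i = a" "vs ! j = b" using v by (auto simp: nth_append)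
  have "vs[i := a * b] = (X @ (a * b) # Y) @ b # Z"
    using v by (simp add: list_update_append)
  then have "remove_nth j (vs[i := a * b]) = (X @ (a * b) # Y) @ Z"
    using v by (simp only: remove_nth_append length_append list.size)
  then show ?thesis unfolding e using v by (simp add: ac_simps)
qed

lemma card_edges_contract:
  assumes wf: "well_formed G" and h: "h \<in> half_edges G" and opp: "opp G' = opp G"
    and H': "half_edges G' = half_edges G - {h, opp G h}"
  shows "card (edges G) = Suc (card (edges G'))"
proof -
  have "edges G = insert {h, opp G h} (edges G')"
  proof -
    have "half_edges G = insert h (insert (opp G h) (half_edges G'))"
      using wf h H' by (auto simp: well_formed_def)
    moreover have "opp G (opp G h) = h" using wf h by (auto simp: well_formed_def)
    ultimately show ?thesis by (auto simp: edges_def opp)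
  qed
  moreover have "{h, opp G h} \<notin> edges G'"
    using H' by (auto simp: edges_def opp)
  moreover have "finite (edges G')" by (simp add: edges_def)
  ultimately show ?thesis by simp
qed

lemma well_formed_contract:
  assumes "well_formed G" "opp G' = opp G" "h \<in> half_edges G"
    "half_edges G' = half_edges G - {h, opp G h}" "distinct (concat (rot G'))"
  shows "well_formed G'"
  using assms unfolding well_formed_def by (metis Diff_iff insert_iff empty_iff)

lemma skip_skip_eq_if_outside:
  "p x \<notin> {h, k} \<Longrightarrow> skip k (skip h (transpose h k \<circ> p)) x = p x"
  by (simp add: skip_def transpose_def)

text \<open>The double first return consults p only at x, h and k. Hence the whole vertex
  permutation may be replaced by the cycles at the endpoints of the contracted edge.\<close>

lemma skip_skip_cong:
  assumes "p x = q x" "p h = q h" "p k = q k"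
  shows "skip k (skip h (transpose h k \<circ> p)) x = skip k (skip h (transpose h k \<circ> q)) x"
  using assms by (simp add: skip_def)

lemma cycle_of_list_merge':
  assumes "distinct (h # as @ k # bs)"
  shows "transpose h k \<circ> cycle_of_list (h # as @ k # bs) =
    cycle_of_list (h # as) \<circ> cycle_of_list (k # bs)"
  unfolding cycle_of_list_merge[OF assms] by (simp flip: comp_assoc)

text \<open>Edge between distinct vertices: the transposition joins the two cycles into one, from
  which h and k are then deleted.\<close>

lemma skip_skip_merge:
  assumes "distinct (h # as @ k # bs)" "x \<notin> {h, k}"
  shows "skip k (skip h (transpose h k \<circ> (cycle_of_list (h # as) \<circ> cycle_of_list (k # bs)))) x =
    cycle_of_list (as @ bs) x"
proof -
  have "cycle_of_list (as @ bs) x = skip k (cycle_of_list (as @ k # bs)) x"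
    by (rule cycle_of_list_remove) (use assms in auto)
  moreover have "cycle_of_list (as @ k # bs) y = skip h (cycle_of_list (h # as @ k # bs)) y" if "y \<noteq> h" for y
    using cycle_of_list_remove[of "[]" h "as @ k # bs" y] assms that by simp
  ultimately show ?thesis
    using assms unfolding cycle_of_list_merge[OF assms(1)] skip_def[of k _ x] by auto
qed

text \<open>Loop: the transposition cuts the cycle into one part with h and one with k. Each
  deletion then affects only its own part, which is why the cases depend on the location of
  x.\<close>

lemma skip_skip_split:
  assumes "distinct (h # as @ k # bs)" "x \<notin> {h, k}"
  shows "skip k (skip h (transpose h k \<circ> cycle_of_list (h # as @ k # bs))) x =
    (cycle_of_list as \<circ> cycle_of_list bs) x"
proof -
  let ?a = "cycle_of_list (h # as)" and ?b = "cycle_of_list (k # bs)"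
  have as: "cycle_of_list as y = skip h ?a y" if "y \<noteq> h" for y
    using cycle_of_list_remove[of "[]" h as y] assms that by simp
  have bs: "cycle_of_list bs y = skip k ?b y" if "y \<noteq> k" for y
    using cycle_of_list_remove[of "[]" k bs y] assms that by simp
  have a: "?a y = y" if "y \<notin> insert h (set as)" for y using that by (intro id_outside_supp) auto
  have b: "?b y = y" if "y \<notin> insert k (set bs)" for y using that by (intro id_outside_supp) auto
  have a': "?a y \<in> insert h (set as) \<longleftrightarrow> y \<in> insert h (set as)" for y
    using cycle_of_list_in_set_iff[of "h # as" y] by simp
  have b': "?b y \<in> insert k (set bs) \<longleftrightarrow> y \<in> insert k (set bs)" for y
    using cycle_of_list_in_set_iff[of "k # bs" y] by simp
  consider "x \<in> set bs" | "x \<notin> set bs" by blast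
  then show ?thesis
    unfolding cycle_of_list_merge'[OF assms(1)]
  proof cases
    case 1
    have k: "?b k \<notin> insert h (set as)" "?b x \<notin> insert h (set as)"
      using b'[of k] b'[of x] 1 assms by auto
    have "cycle_of_list bs x \<in> set bs" using 1 by (simp add: cycle_of_list_in_set_iff)
    then have "cycle_of_list as (cycle_of_list bs x) = cycle_of_list bs x"
      using assms by (intro id_outside_supp) auto
    moreover have "?a k = k" using a assms by auto
    ultimately show "skip k (skip h (?a \<circ> ?b)) x = (cycle_of_list as \<circ> cycle_of_list bs) x"
      using assms bs[of x] k a[of "?b k"] a[of "?b x"] by (auto simp: skip_def)
  next
    case 2
    have "cycle_of_list bs x = x" "?b x = x" "?b h = h" using 2 assms b id_outside_supp[of x bs] by auto
    moreover have "?a x \<noteq> k" "?a h \<noteq> k" using a'[of x] a'[of h] a[of x] assms by force+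
    ultimately show "skip k (skip h (?a \<circ> ?b)) x = (cycle_of_list as \<circ> cycle_of_list bs) x"
      using assms as[of x] by (auto simp: skip_def)
  qed
qed

lemma distinct_merge_append:
  assumes "distinct (xs @ rs @ ys @ ts @ zs)" "set as \<subseteq> set rs" "set bs \<subseteq> set ts"
    "distinct as" "distinct bs"
  shows "distinct (xs @ (as @ bs) @ ys @ zs)"
proof -
  have "set as \<inter> set bs = {}" "set as \<inter> (set xs \<union> set ys \<union> set zs) = {}"
    "set bs \<inter> (set xs \<union> set ys \<union> set zs) = {}"
    using assms(1-3) by auto
  then show ?thesis using assms(1,4,5) by auto
qed

lemma num_faces_contract_edge:
  fixes G h as bs X Y Z
  defines "k \<equiv> opp G h"
  assumes wf: "well_formed G" and R: "rot G = X @ ri # Y @ rj # Z"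
    and ri: "cyc_eq ri (h # as)" and rj: "cyc_eq rj (k # bs)"
  defines "G' \<equiv> Cell_Graph (X @ (as @ bs) # Y @ Z) (opp G)"
  shows "half_edges G' = half_edges G - {h, k}" "distinct (concat (rot G'))"
    "num_faces G' = num_faces G"
proof -
  have si: "set ri = insert h (set as)" and sj: "set rj = insert k (set bs)"
    and di: "distinct (h # as)" and dj: "distinct (k # bs)"
    and dd: "distinct (concat (X @ ri # Y @ rj # Z))"
    and dd': "distinct ri" "distinct rj"
    using cyc_eq_imp[OF ri] cyc_eq_imp[OF rj] wf R by (auto simp: well_formed_def)
  show H': "half_edges G' = half_edges G - {h, k}"
    using dd si sj di dj by (auto simp: half_edges_def G'_def R)
  have ab: "distinct (h # as @ k # bs)" using dd si sj di dj by auto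
  show d': "distinct (concat (rot G'))"
    using distinct_merge_append[of "concat X" ri "concat Y" rj "concat Z" as bs] dd si sj di dj
    by (auto simp only: G'_def cell_graph.sel concat.simps concat_append distinct.simps)
  have si_i: "vertex_perm G x = cycle_of_list (h # as) x" if "x \<in> insert h (set as)" for x
    using cycles_perm_apply[of "rot G" ri x] cyc_eq_imp(3)[OF ri dd'(1)] dd that si
    by (simp add: vertex_perm_eq R)
  have si_j: "vertex_perm G x = cycle_of_list (k # bs) x" if "x \<in> insert k (set bs)" for x
    using cycles_perm_apply[of "rot G" rj x] cyc_eq_imp(3)[OF rj dd'(2)] dd that sj
    by (simp add: vertex_perm_eq R)
  let ?c = "cycle_of_list (h # as) \<circ> cycle_of_list (k # bs)"
  \<comment> \<open>The two cycles are disjoint, so at each of their points one factor of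
    \<open>?c\<close> acts trivially.\<close>
  have s: "vertex_perm G x = ?c x" if "x \<in> set (h # as @ k # bs)" for x
  proof (cases "x \<in> insert h (set as)")
    case True
    then have "cycle_of_list (k # bs) x = x" using ab by (intro id_outside_supp) auto
    then show ?thesis using si_i[OF True] by simp
  next
    case False
    then have x: "x \<in> insert k (set bs)" using that by auto
    then have "cycle_of_list (k # bs) x \<in> set (k # bs)" by (simp only: cycle_of_list_in_set_iff) simp
    then have "?c x = cycle_of_list (k # bs) x"
      using ab unfolding comp_apply by (intro id_outside_supp) auto
    then show ?thesis using si_j[OF x] by simp
  qed
  show "num_faces G' = num_faces G"
  proof (rule num_faces_contract[OF wf, of h])
    show h: "h \<in> half_edges G" using si by (auto simp: half_edges_def R)
    show "opp G' = opp G" by (simp add: G'_def)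
    show "half_edges G' = half_edges G - {h, opp G h}" using H' k_def by simp
    fix x assume x: "x \<in> half_edges G'"
    show "vertex_perm G' x = skip (opp G h) (skip h (transpose h (opp G h) \<circ> vertex_perm G)) x"
    proof (cases "x \<in> set (as @ bs)")
      case True
      then have "vertex_perm G' x = cycle_of_list (as @ bs) x"
        unfolding vertex_perm_eq
        using d' by (intro cycles_perm_apply) (auto simp: G'_def)
      also have "\<dots> = skip k (skip h (transpose h k \<circ> ?c)) x"
        by (rule sym, rule skip_skip_merge[OF ab]) (use x H' in auto)
      also have "\<dots> = skip k (skip h (transpose h k \<circ> vertex_perm G)) x"
        by (rule skip_skip_cong) (use s True in auto)
      finally show ?thesis by (simp add: k_def)
    next
      case False
      then obtain hs where hs: "hs \<in> set (X @ Y @ Z)" "x \<in> set hs"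
        using x by (auto simp: G'_def half_edges_def)
      have "vertex_perm G' x = cycle_of_list hs x" "vertex_perm G x = cycle_of_list hs x"
        unfolding vertex_perm_eq using d' dd hs
        by (auto intro!: cycles_perm_apply simp: G'_def R)
      moreover have "cycle_of_list hs x \<in> set hs" using hs by (simp add: cycle_of_list_in_set_iff)
      then have "cycle_of_list hs x \<notin> {h, k}" using dd hs si sj by auto
      ultimately show ?thesis using skip_skip_eq_if_outside by (metis k_def)
    qed
  next
    \<comment> \<open>With h and k at different vertices, neither s k = h nor s h = k can occur.
      What remains is s h = h and s k = k, that is, both \<open>as\<close> and \<open>bs\<close> are
      empty and the merged vertex is isolated.\<close>
    have "ri \<noteq> []" "rj \<noteq> []" using si sj by auto
    moreover have "vertex_perm G h = hd (as @ [h])" "vertex_perm G k = hd (bs @ [k])"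
      using si_i[of h] si_j[of k] cycle_of_list_Cons_hd[OF di] cycle_of_list_Cons_hd[OF dj]
      by simp_all
    moreover have "hd (bs @ [k]) \<noteq> h" "hd (as @ [h]) \<noteq> k"
      "hd (bs @ [k]) = k \<longleftrightarrow> bs = []" "hd (as @ [h]) = h \<longleftrightarrow> as = []"
      using ab by (cases as; cases bs; auto)+
    ultimately show "length (filter (\<lambda>hs. hs = []) (rot G')) =
      length (filter (\<lambda>hs. hs = []) (rot G)) +
      (if vertex_perm G (opp G h) = h then 1 else 0) +
      (if vertex_perm G h = opp G h \<or> vertex_perm G h = h \<and> vertex_perm G (opp G h) = opp G h
       then 1 else 0)"
      by (simp add: G'_def R flip: k_def)
  qed
qed

lemma num_faces_contract_loop:
  fixes G h as bs
  defines "k \<equiv> opp G h"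
  assumes wf: "well_formed G" and R: "rot G = [r]"
    and r: "cyc_eq r (h # as @ k # bs)"
  defines "G' \<equiv> Cell_Graph [as, bs] (opp G)"
  shows "half_edges G' = half_edges G - {h, k}" "distinct (concat (rot G'))"
    "num_faces G' = num_faces G"
proof -
  have sr: "set r = insert h (insert k (set as \<union> set bs))"
    and dr: "distinct r" and ab: "distinct (h # as @ k # bs)"
    using cyc_eq_imp[OF r] wf R by (auto simp: well_formed_def)
  show H': "half_edges G' = half_edges G - {h, k}"
    using sr ab by (auto simp: half_edges_def G'_def R)
  show d': "distinct (concat (rot G'))"
    using ab by (auto simp: G'_def)
  have s: "vertex_perm G = cycle_of_list (h # as @ k # bs)"
    using cyc_eq_imp(3)[OF r dr] by (simp add: vertex_perm_eq R)
  have s': "vertex_perm G' = cycle_of_list as \<circ> cycle_of_list bs"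
    by (simp add: vertex_perm_eq G'_def)
  show "num_faces G' = num_faces G"
  proof (rule num_faces_contract[OF wf, of h])
    show h: "h \<in> half_edges G" using sr by (auto simp: half_edges_def R)
    show "opp G' = opp G" by (simp add: G'_def)
    show "half_edges G' = half_edges G - {h, opp G h}" using H' k_def by simp
    show "vertex_perm G' x = skip (opp G h) (skip h (transpose h (opp G h) \<circ> vertex_perm G)) x"
      if "x \<in> half_edges G'" for x
      using skip_skip_split[OF ab, of x] that H' by (simp add: s s' flip: k_def)
    \<comment> \<open>Here s h = k exactly if \<open>as\<close> is empty, and s k = h exactly if
      \<open>bs\<close> is empty. So every orbit lost is matched by one new isolated vertex.\<close>
    have "r \<noteq> []" using sr by auto
    moreover have "vertex_perm G h = hd (as @ [k])"
      using cycle_of_list_Cons_hd[OF ab] unfolding s by (cases as) auto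
    moreover have "vertex_perm G k = hd (bs @ [h])"
    proof -
      have "cycle_of_list (h # as @ k # bs) = cycle_of_list (k # bs @ h # as)"
        using cycle_of_list_append_commute[of "h # as" "k # bs"] ab by simp
      then show ?thesis using cycle_of_list_Cons_hd[of k "bs @ h # as"] ab unfolding s by (cases bs) auto
    qed
    moreover have "hd (bs @ [h]) = h \<longleftrightarrow> bs = []" "hd (as @ [k]) = k \<longleftrightarrow> as = []"
      "hd (bs @ [h]) \<noteq> k" "h \<noteq> k"
      using ab by (cases as; cases bs; auto)+
    ultimately show "length (filter (\<lambda>hs. hs = []) (rot G')) =
      length (filter (\<lambda>hs. hs = []) (rot G)) +
      (if vertex_perm G (opp G h) = h then 1 else 0) +
      (if vertex_perm G h = opp G h \<or> vertex_perm G h = h \<and> vertex_perm G (opp G h) = opp G h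
       then 1 else 0)"
      by (simp add: G'_def R flip: k_def)
  qed
qed

text \<open>Well-formedness makes f preserve \<open>as\<close> and \<open>bs\<close> separately. The
  joint face permutation therefore restricts to those of the two parts, and its orbits never mix
  them.\<close>

lemma num_faces_disjoint:
  assumes "well_formed (Cell_Graph [as] f)" "well_formed (Cell_Graph [bs] f)"
    and "distinct (as @ bs)"
  shows "num_faces (Cell_Graph [as, bs] f) = num_faces (Cell_Graph [as] f) + num_faces (Cell_Graph [bs] f)"
proof -
  let ?p = "\<lambda>R. vertex_perm (Cell_Graph R f) \<circ> f"
  have inv: "f x \<in> set as" if "x \<in> set as" for x
    using assms(1) that by (auto simp: well_formed_def half_edges_def)
  have inv': "f x \<in> set bs" if "x \<in> set bs" for x
    using assms(2) that by (auto simp: well_formed_def half_edges_def)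
  have cin: "cycle_of_list cs x \<in> set cs" if "x \<in> set cs" for cs and x :: nat
    using that by (simp add: cycle_of_list_in_set_iff)
  have a: "?p [as] x = ?p [as, bs] x \<and> ?p [as] x \<in> set as" if "x \<in> set as" for x
  proof -
    have "f x \<notin> set bs" using inv[OF that] assms(3) by auto
    then show ?thesis using inv[OF that] cin by (simp add: vertex_perm_eq id_outside_supp)
  qed
  have b: "?p [bs] x = ?p [as, bs] x \<and> ?p [bs] x \<in> set bs" if "x \<in> set bs" for x
  proof -
    have "cycle_of_list bs (f x) \<in> set bs" using inv'[OF that] cin by simp
    moreover from this have "cycle_of_list bs (f x) \<notin> set as" using assms(3) by auto
    ultimately show ?thesis by (simp add: vertex_perm_eq id_outside_supp)
  qed
  have oa: "orbit (?p [as]) x = orbit (?p [as, bs]) x" if "x \<in> set as" for x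
  proof (rule orbit_cong0[OF that])
    show "?p [as] \<in> set as \<rightarrow> set as" using a by blast
    show "?p [as] y = ?p [as, bs] y" if "y \<in> set as" for y using a that by blast
  qed
  have ob: "orbit (?p [bs]) x = orbit (?p [as, bs]) x" if "x \<in> set bs" for x
  proof (rule orbit_cong0[OF that])
    show "?p [bs] \<in> set bs \<rightarrow> set bs" using b by blast
    show "?p [bs] y = ?p [as, bs] y" if "y \<in> set bs" for y using b that by blast
  qed
  have sa: "orbit (?p [as]) x \<subseteq> set as" if "x \<in> set as" for x
  proof
    fix y assume "y \<in> orbit (?p [as]) x"
    then show "y \<in> set as"
    proof induction
      case base show ?case using a that by blast
    next
      case (step y) then show ?case using a by blast
    qed
  qed
  have sb: "orbit (?p [bs]) x \<subseteq> set bs" if "x \<in> set bs" for x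
  proof
    fix y assume "y \<in> orbit (?p [bs]) x"
    then show "y \<in> set bs"
    proof induction
      case base show ?case using b that by blast
    next
      case (step y) then show ?case using b by blast
    qed
  qed
  have "orbit (?p [as]) ` set as \<inter> orbit (?p [bs]) ` set bs = {}"
  proof (rule ccontr)
    assume "orbit (?p [as]) ` set as \<inter> orbit (?p [bs]) ` set bs \<noteq> {}"
    then obtain x y where "x \<in> set as" "y \<in> set bs" "orbit (?p [as]) x = orbit (?p [bs]) y" by auto
    then have "?p [as] x \<in> set as \<inter> set bs" using sa sb orbit.base[of "?p [as]" x] by blast
    then show False using assms(3) by auto
  qed
  then have "card (orbit (?p [as]) ` set as \<union> orbit (?p [bs]) ` set bs) =
    card (orbit (?p [as]) ` set as) + card (orbit (?p [bs]) ` set bs)"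
    by (intro card_Un_disjoint) auto
  moreover have "orbit (?p [as, bs]) ` (set as \<union> set bs) =
      orbit (?p [as]) ` set as \<union> orbit (?p [bs]) ` set bs"
    unfolding image_Un using oa ob by (metis (no_types, lifting) image_cong)
  ultimately show ?thesis by (simp add: num_faces_def half_edges_def)
qed

section \<open>Induction over cell graphs\<close>

lemma distinct_concat_nth_eq:
  assumes "distinct (concat R)" "a < length R" "b < length R" "x \<in> set (R ! a)" "x \<in> set (R ! b)"
  shows "a = b"
  using assms
proof (induction R arbitrary: a b)
  case (Cons r R)
  have *: "x \<notin> set (R ! m)" if "x \<in> set r" "m < length R" for m
  proof
    assume "x \<in> set (R ! m)"
    then have "x \<in> set (concat R)" using nth_mem[OF that(2)] by auto
    then show False using Cons.prems(1) that(1) by auto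
  qed
  show ?case
    using Cons * by (cases a; cases b) auto
qed simp

text \<open>The quotient map q on vertex labels sends paths to paths and is onto, so connectedness
  passes to the contracted graph.\<close>

lemma connected_contract_edge:
  assumes wf: "well_formed G" and R: "rot G = X @ ri # Y @ rj # Z"
    and ri: "set ri = insert h (set as)" and rj: "set rj = insert (opp G h) (set bs)"
    and con: "connected_graph G"
  shows "connected_graph (Cell_Graph (X @ (as @ bs) # Y @ Z) (opp G))" (is "connected_graph ?G'")
proof -
  define i j where "i = length X" and "j = length X + length Y + 1"
  define q where "q m = (if m = j then i else if m < j then m else m - 1)" for m
  have len: "i < j" "j < length (rot G)" "length (rot ?G') = length (rot G) - 1"
    by (simp_all add: i_def j_def R)
  have Ri: "rot G ! i = ri" and Rj: "rot G ! j = rj"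
    by (simp_all add: i_def j_def R nth_append)
  have q_lt: "q m < length (rot ?G')" if "m < length (rot G)" for m
    using that len by (auto simp: q_def)
  have mem: "x \<in> set (rot ?G' ! q m)"
    if "m < length (rot G)" "x \<in> set (rot G ! m)" "x \<notin> {h, opp G h}" for x m
  proof -
    consider "m < i" | "m = i" | "i < m" "m < j" | "m = j" | "m > j" by linarith
    then show ?thesis
    proof cases
      case 1
      then show ?thesis using that by (simp add: q_def i_def j_def R nth_append)
    next
      case 2
      then have "q m = i" using len by (simp add: q_def)
      then show ?thesis using that 2 Ri ri by (auto simp: i_def)
    next
      case 3
      then have "m - i - 1 < length Y" by (simp add: i_def j_def)
      then have "rot G ! m = Y ! (m - i - 1)" "rot ?G' ! m = Y ! (m - i - 1)"
        using 3 by (auto simp: R nth_append i_def nth_Cons')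
      then show ?thesis using that 3 by (simp add: q_def)
    next
      case 4
      then have "q m = i" by (simp add: q_def)
      then show ?thesis using that 4 Rj rj by (auto simp: i_def)
    next
      case 5
      then have "rot G ! m = Z ! (m - j - 1)" "rot ?G' ! (m - 1) = Z ! (m - j - 1)"
        by (auto simp: R nth_append i_def j_def nth_Cons')
      then show ?thesis using that 5 by (simp add: q_def)
    qed
  qed
  have d: "distinct (concat (rot G))" using wf by (simp add: well_formed_def)
  \<comment> \<open>The closure is needed because the contracted edge becomes the trivial path at i.
    All other edges keep their half-edges.\<close>
  have adj: "(q a, q b) \<in> (adjacent ?G')\<^sup>*" if ab: "(a, b) \<in> adjacent G" for a b
  proof -
    obtain x where x: "a < length (rot G)" "b < length (rot G)"
      "x \<in> set (rot G ! a)" "opp G x \<in> set (rot G ! b)"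
      using ab by (auto simp: adjacent_def)
    have H: "h \<in> half_edges G" "x \<in> half_edges G"
      using x ri nth_mem[of a "rot G"] by (auto simp: half_edges_def R)
    have oo: "opp G (opp G h) = h" "opp G (opp G x) = x" using wf H by (auto simp: well_formed_def)
    consider "x = h" | "x = opp G h" | "x \<notin> {h, opp G h}" by blast
    then show ?thesis
    proof cases
      case 1
      have "a = i" by (rule distinct_concat_nth_eq[OF d x(1) _ x(3)]) (use len Ri ri 1 in auto)
      moreover have "b = j" by (rule distinct_concat_nth_eq[OF d x(2) _ x(4)]) (use len Rj rj 1 in auto)
      ultimately show ?thesis using len by (simp add: q_def)
    next
      case 2
      have "a = j" by (rule distinct_concat_nth_eq[OF d x(1) _ x(3)]) (use len Rj rj 2 in auto)
      moreover have "b = i" by (rule distinct_concat_nth_eq[OF d x(2) _ x(4)]) (use len Ri ri 2 oo in auto)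
      ultimately show ?thesis using len by (simp add: q_def)
    next
      case 3
      then have "opp G x \<notin> {h, opp G h}" using oo by auto
      then have "x \<in> set (rot ?G' ! q a)" "opp ?G' x \<in> set (rot ?G' ! q b)"
        using mem[OF x(1,3) 3] mem[OF x(2,4)] by auto
      then have "(q a, q b) \<in> adjacent ?G'"
        using q_lt x(1,2) unfolding adjacent_def by blast
      then show ?thesis by blast
    qed
  qed
  have path: "(q a, q b) \<in> (adjacent ?G')\<^sup>*" if "(a, b) \<in> (adjacent G)\<^sup>*" for a b
    using that by induction (auto intro: adj rtrancl_trans)
  have surj: "\<exists>m < length (rot G). q m = l" if "l < length (rot ?G')" for l
  proof (cases "l < j")
    case True
    then show ?thesis using len that by (intro exI[of _ l]) (auto simp: q_def)
  next
    case False
    then show ?thesis using len that by (intro exI[of _ "Suc l"]) (auto simp: q_def)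
  qed
  show ?thesis unfolding connected_graph_def
  proof (intro conjI allI impI)
    show "rot ?G' \<noteq> []" by simp
    fix a b assume "a < length (rot ?G')" "b < length (rot ?G')"
    then obtain a' b' where "a' < length (rot G)" "q a' = a" "b' < length (rot G)" "q b' = b"
      using surj by metis
    then show "(a, b) \<in> (adjacent ?G')\<^sup>*"
      using path con unfolding connected_graph_def by blast
  qed
qed

lemma ex_cyc_eq_Cons:
  assumes "x \<in> set xs"
  obtains as where "cyc_eq xs (x # as)"
proof -
  obtain ys zs where "xs = ys @ x # zs" using assms by (meson split_list)
  then have "rotate (length ys) xs = x # zs @ ys" by (simp add: rotate_append)
  then show ?thesis using that by (auto simp: cyc_eq_def)
qed

lemma connected_graph_single: "length (rot G) = 1 \<Longrightarrow> connected_graph G"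
  by (auto simp: connected_graph_def)

lemma all_loops_imp_single:
  assumes "connected_graph G"
    and "\<And>i j. (i, j) \<in> adjacent G \<Longrightarrow> i = j"
  shows "length (rot G) = 1"
proof (rule ccontr)
  assume "length (rot G) \<noteq> 1"
  then have "1 < length (rot G)" using assms(1) by (cases "rot G") (auto simp: connected_graph_def)
  moreover from this have "0 < length (rot G)" by linarith
  ultimately have "(0, 1) \<in> (adjacent G)\<^sup>*" using assms(1) unfolding connected_graph_def by blast
  moreover have "adjacent G \<subseteq> Id" using assms(2) by auto
  ultimately have "(0::nat, 1::nat) \<in> Id\<^sup>*" using rtrancl_mono by blast
  then show False by simp
qed

text \<open>An integer attached to any graph, with no genus presupposed, so that its changes under
  contraction can be stated before it is known to be 2 - 2g.\<close>

definition euler_char :: "cell_graph \<Rightarrow> int" where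
  "euler_char G = int (length (rot G)) - int (card (edges G)) + int (num_faces G)"

lemma mem_cell_graphs_iff:
  "G \<in> cell_graphs g n \<longleftrightarrow>
    well_formed G \<and> connected_graph G \<and> length (rot G) = n \<and> euler_char G = 2 - 2 * int g"
  by (auto simp: cell_graphs_def euler_char_def)

lemma euler_char_contract_edge:
  fixes G h
  defines "k \<equiv> opp G h"
  assumes wf: "well_formed G" and R: "rot G = X @ ri # Y @ rj # Z"
    and ri: "cyc_eq ri (h # as)" and rj: "cyc_eq rj (k # bs)"
  defines "G' \<equiv> Cell_Graph (X @ (as @ bs) # Y @ Z) (opp G)"
  shows "euler_char G' = euler_char G" "well_formed G'" "card (half_edges G') < card (half_edges G)"
proof -
  note nf = num_faces_contract_edge[OF wf R ri rj[unfolded k_def], folded k_def G'_def]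
  have h: "h \<in> half_edges G" using cyc_eq_imp(1)[OF ri] by (auto simp: half_edges_def R)
  have o: "opp G' = opp G" by (simp add: G'_def)
  show "well_formed G'" using well_formed_contract[OF wf o h] nf(1,2) k_def by simp
  have "card (edges G) = Suc (card (edges G'))"
    using card_edges_contract[OF wf h o] nf(1) k_def by simp
  then show "euler_char G' = euler_char G" using nf(3) by (simp add: euler_char_def R) (simp add: G'_def)
  show "card (half_edges G') < card (half_edges G)"
    by (rule psubset_card_mono) (use nf(1) h in auto)
qed

text \<open>The increase by 2 comes from one more vertex and one edge fewer, with the number of
  faces unchanged.\<close>

lemma euler_char_contract_loop:
  fixes G h
  defines "k \<equiv> opp G h"
  assumes wf: "well_formed G" and R: "rot G = [r]"
    and r: "cyc_eq r (h # as @ k # bs)"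
  defines "G' \<equiv> Cell_Graph [as, bs] (opp G)"
  shows "euler_char G' = euler_char G + 2" "well_formed G'"
    "half_edges G' = half_edges G - {h, k}" "h \<in> half_edges G"
proof -
  note nf = num_faces_contract_loop[OF wf R r[unfolded k_def], folded k_def G'_def]
  show h: "h \<in> half_edges G" using cyc_eq_imp(1)[OF r] by (auto simp: half_edges_def R)
  have o: "opp G' = opp G" by (simp add: G'_def)
  show "half_edges G' = half_edges G - {h, k}" by (rule nf(1))
  show "well_formed G'" using well_formed_contract[OF wf o h] nf(1,2) k_def by simp
  have "card (edges G) = Suc (card (edges G'))"
    using card_edges_contract[OF wf h o] nf(1) k_def by simp
  then show "euler_char G' = euler_char G + 2" using nf(3) by (simp add: euler_char_def R) (simp add: G'_def)
qed

lemma euler_char_disjoint: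
  assumes wf: "well_formed (Cell_Graph [as] f)" "well_formed (Cell_Graph [bs] f)"
    and d: "distinct (as @ bs)"
  shows "euler_char (Cell_Graph [as, bs] f) =
    euler_char (Cell_Graph [as] f) + euler_char (Cell_Graph [bs] f)"
proof -
  have "edges (Cell_Graph [as, bs] f) = edges (Cell_Graph [as] f) \<union> edges (Cell_Graph [bs] f)"
    by (auto simp: edges_def half_edges_def)
  moreover have "edges (Cell_Graph [as] f) \<inter> edges (Cell_Graph [bs] f) = {}"
  proof (rule ccontr)
    assume "edges (Cell_Graph [as] f) \<inter> edges (Cell_Graph [bs] f) \<noteq> {}"
    then obtain x y where "x \<in> set as" "y \<in> set bs" "{x, f x} = {y, f y}"
      by (auto simp: edges_def half_edges_def)
    moreover from this have "f y \<in> set bs" using wf(2) by (auto simp: well_formed_def half_edges_def)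
    ultimately show False using d by (auto simp: doubleton_eq_iff)
  qed
  ultimately have "card (edges (Cell_Graph [as, bs] f)) =
      card (edges (Cell_Graph [as] f)) + card (edges (Cell_Graph [bs] f))"
    by (simp add: card_Un_disjoint edges_def)
  then show ?thesis using num_faces_disjoint[OF assms] by (simp add: euler_char_def)
qed

text \<open>Every contraction lowers the number of half-edges. A connected graph without edges
  between distinct vertices has one vertex, and splitting it gives either two vertices joined by an
  edge or two one-vertex graphs, whose connectedness is automatic.\<close>

lemma cell_graph_induct [consumes 2, case_names point edge loop_connected loop_disconnected]:
  assumes "well_formed G" "connected_graph G"
    and point: "\<And>G. rot G = [[]] \<Longrightarrow> euler_char G = 2 \<Longrightarrow> P G"
    and edge: "\<And>G G' i j. \<lbrakk>well_formed G; connected_graph G; well_formed G'; connected_graph G';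
      contracts_edge G i j G'; length (rot G) = Suc (length (rot G'));
      euler_char G = euler_char G'; P G'\<rbrakk> \<Longrightarrow> P G"
    and loop_connected: "\<And>G G'. \<lbrakk>well_formed G; connected_graph G; length (rot G) = 1;
      well_formed G'; connected_graph G'; length (rot G') = 2; contracts_loop G 0 G';
      euler_char G = euler_char G' - 2; P G'\<rbrakk> \<Longrightarrow> P G"
    and loop_disconnected: "\<And>G G1 G2. \<lbrakk>well_formed G; connected_graph G; length (rot G) = 1;
      well_formed G1; connected_graph G1; length (rot G1) = 1;
      well_formed G2; connected_graph G2; length (rot G2) = 1;
      contracts_loop_disconnected G 0 {} {} G1 G2;
      euler_char G = euler_char G1 + euler_char G2 - 2; P G1; P G2\<rbrakk> \<Longrightarrow> P G"
  shows "P G"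
  using assms(1,2)
proof (induction "card (half_edges G)" arbitrary: G rule: less_induct)
  case less
  note wf = less.prems(1) and con = less.prems(2)
  have inv: "opp G x \<in> half_edges G" "opp G x \<noteq> x" "opp G (opp G x) = x" if "x \<in> half_edges G" for x
    using wf that by (auto simp: well_formed_def)
  consider (nonloop) i j where "(i, j) \<in> adjacent G" "i < j" | (single) "length (rot G) = 1"
  proof (cases "\<exists>i j. (i, j) \<in> adjacent G \<and> i \<noteq> j")
    case True
    then obtain i j where ij: "(i, j) \<in> adjacent G" "i \<noteq> j" by blast
    then obtain x where x: "i < length (rot G)" "j < length (rot G)" "x \<in> set (rot G ! i)"
      "opp G x \<in> set (rot G ! j)" by (auto simp: adjacent_def)
    then have "x \<in> half_edges G" using nth_mem by (fastforce simp: half_edges_def)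
    \<comment> \<open>Adjacency is symmetric because \<open>opp\<close> is an involution;
      contraction requires the smaller label to come first.\<close>
    then have "(j, i) \<in> adjacent G"
      using x inv(3) unfolding adjacent_def by (auto intro!: bexI[of _ "opp G x"])
    then show ?thesis using nonloop ij by (metis linorder_neqE_nat)
  next
    case False
    then show ?thesis using single all_loops_imp_single[OF con] by blast
  qed
  then show ?case
  proof cases
    case nonloop
    then obtain h where h: "j < length (rot G)" "h \<in> set (rot G ! i)" "opp G h \<in> set (rot G ! j)"
      by (auto simp: adjacent_def)
    obtain as bs where ab: "cyc_eq (rot G ! i) (h # as)" "cyc_eq (rot G ! j) (opp G h # bs)"
      using h(2,3) ex_cyc_eq_Cons by metis
    obtain X Y Z where XYZ: "rot G = X @ rot G ! i # Y @ rot G ! j # Z" "length X = i" "length X + length Y + 1 = j"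
      using split_list_two[OF nonloop(2) h(1)] .
    define G' where "G' = Cell_Graph (X @ (as @ bs) # Y @ Z) (opp G)"
    note e = euler_char_contract_edge[OF wf XYZ(1) ab, folded G'_def]
    have con': "connected_graph G'" unfolding G'_def
      using connected_contract_edge[OF wf XYZ(1) _ _ con] cyc_eq_imp(1)[OF ab(1)] cyc_eq_imp(1)[OF ab(2)]
      by simp
    have "(rot G)[i := as @ bs] = (X @ (as @ bs) # Y) @ rot G ! j # Z"
      using XYZ(2) by (subst XYZ(1)) (simp add: list_update_append)
    then have "remove_nth j ((rot G)[i := as @ bs]) = X @ (as @ bs) # Y @ Z"
      using XYZ(2,3) by (simp del: append_assoc append_Cons)
    then have "contracts_edge G i j G'"
      unfolding contracts_edge_def G'_def using nonloop(2) h(1) ab by metis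
    moreover have "length (rot G) = Suc (length (rot G'))"
      by (subst XYZ(1)) (simp add: G'_def)
    ultimately show ?thesis
      using edge[OF wf con e(2) con'] e(1) less.hyps[OF e(3) e(2) con'] by simp
  next
    case single
    then obtain r where R: "rot G = [r]" by (auto simp: length_Suc_conv)
    have Hr: "half_edges G = set r" by (simp add: half_edges_def R)
    show ?thesis
    proof (cases r)
      case Nil
      \<comment> \<open>One vertex, no edge, and one face, which comes from the summand for empty
        rotations.\<close>
      then have "euler_char G = 2" by (simp add: euler_char_def edges_def num_faces_def half_edges_def R)
      then show ?thesis using point R Nil by simp
    next
      case (Cons h t)
      have "h \<in> half_edges G" using Cons Hr by simp
      then have "opp G h \<in> set t" using inv[of h] Cons Hr by auto
      then obtain as bs where "t = as @ opp G h # bs" by (meson split_list)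
      then have cyc: "cyc_eq r (h # as @ opp G h # bs)"
        unfolding cyc_eq_def by (intro exI[of _ 0]) (simp add: Cons)
      then have split: "splits_vertex G 0 as bs" by (auto simp: splits_vertex_def R)
      define G' where "G' = Cell_Graph [as, bs] (opp G)"
      note e = euler_char_contract_loop[OF wf R cyc, folded G'_def]
      have H': "half_edges G' = set as \<union> set bs" by (auto simp: G'_def half_edges_def)
      have dab: "distinct (as @ bs)" using e(2) by (simp add: well_formed_def G'_def)
      have inv': "opp G x \<in> set as \<union> set bs" "opp G (opp G x) = x" "opp G x \<noteq> x"
        if "x \<in> set as \<union> set bs" for x
        using e(2) that unfolding well_formed_def H' by (auto simp: G'_def)
      have less: "card (half_edges K) < card (half_edges G)" if "half_edges K \<subseteq> half_edges G'" for K
        by (rule psubset_card_mono) (use e(3,4) that in auto)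
      show ?thesis
      proof (cases "\<exists>x\<in>set as. opp G x \<in> set bs")
        case True
        then obtain x where x: "x \<in> set as" "opp G x \<in> set bs" by blast
        have "(0, 1) \<in> adjacent G'" unfolding adjacent_def using x by (auto simp: G'_def)
        moreover have "opp G (opp G x) \<in> set as" using inv'(2)[of x] x by simp
        then have "(1, 0) \<in> adjacent G'" unfolding adjacent_def using x(2) by (auto simp: G'_def)
        ultimately have con': "connected_graph G'"
          by (auto simp: connected_graph_def G'_def less_Suc_eq)
        have "contracts_loop G 0 G'"
          unfolding contracts_loop_def using split by (auto simp: G'_def replace_by_two_def R)
        then show ?thesis
          using loop_connected[OF wf con single e(2) con'] e(1)
            less.hyps[OF less[OF order_refl] e(2) con'] by (simp add: G'_def)
      next
        case False
        define G1 G2 where "G1 = Cell_Graph [as] (opp G)" and "G2 = Cell_Graph [bs] (opp G)"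
        have "opp G x \<in> set as" if "x \<in> set as" for x using False inv'[of x] that by blast
        moreover have "opp G x \<in> set bs" if "x \<in> set bs" for x
          using False inv'[of x] that dab by (metis UnE UnI2)
        ultimately have wf': "well_formed G1" "well_formed G2"
          using inv'(2,3) dab by (auto simp: well_formed_def G1_def G2_def half_edges_def)
        have con': "connected_graph G1" "connected_graph G2" "length (rot G1) = 1" "length (rot G2) = 1"
          by (simp_all add: connected_graph_single G1_def G2_def)
        have "contracts_loop_disconnected G 0 {} {} G1 G2"
          unfolding contracts_loop_disconnected_def using split wf'
          by (auto simp: R G1_def G2_def nths_singleton)
        moreover have "euler_char G = euler_char G1 + euler_char G2 - 2"
          using e(1) euler_char_disjoint[of as "opp G" bs] wf' dab by (simp add: G'_def G1_def G2_def)
        moreover have "P G1" "P G2"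
          using less.hyps[OF less] wf' con' H' by (auto simp: G1_def G2_def half_edges_def)
        ultimately show ?thesis using loop_disconnected[OF wf con single] wf' con' by blast
      qed
    qed
  qed
qed

text \<open>Contraction retains the function \<open>opp\<close> of the original graph, whereas ECA 0
  speaks of \<open>id\<close>. On an empty set of half-edges both give the same class.\<close>

lemma iso_class_no_half_edges:
  assumes "rot G = [[]]"
  shows "iso_class G = iso_class (Cell_Graph [[]] id)"
  using assms by (simp add: iso_class_def graph_iso_def half_edges_def)

lemma (in frobenius_algebra) edge_contraction_formula:
  assumes "ECA0 \<eta> \<Omega>" "ECA1 \<Omega>" "ECA2_connected Basis \<eta> \<Omega>" "ECA2_disconnected Basis \<eta> \<Omega>"
    and "well_formed G" "connected_graph G"
  shows "\<exists>g. G \<in> cell_graphs g (length (rot G)) \<and> (\<forall>vs. length vs = length (rot G) \<longrightarrow>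
    \<Omega> (iso_class G) vs = counit \<eta> (prod_list vs * euler_element scale Basis \<eta> ^ g))"
  using assms(5,6)
proof (induction rule: cell_graph_induct)
  case (point G)
  have "well_formed G" by (simp add: well_formed_def half_edges_def point)
  then have "G \<in> cell_graphs 0 (length (rot G))"
    using point connected_graph_single[of G] by (simp add: mem_cell_graphs_iff)
  moreover have "\<Omega> (iso_class G) vs = counit \<eta> (prod_list vs * euler_element scale Basis \<eta> ^ 0)"
    if "length vs = length (rot G)" for vs
  proof -
    have "length vs = Suc 0" using that point(1) by simp
    then obtain v where "vs = [v]" by (auto simp: length_Suc_conv)
    then show ?thesis using assms(1) iso_class_no_half_edges[OF point(1)] by (simp add: ECA0_def)
  qed
  ultimately show ?case by blast
next
  case (edge G G' i j)
  then obtain g where g: "G' \<in> cell_graphs g (length (rot G'))"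
    "\<And>vs. length vs = length (rot G') \<Longrightarrow>
      \<Omega> (iso_class G') vs = counit \<eta> (prod_list vs * euler_element scale Basis \<eta> ^ g)" by blast
  have G: "G \<in> cell_graphs g (length (rot G))" using edge g(1) by (simp add: mem_cell_graphs_iff)
  have ij: "i < j" "j < length (rot G)" using edge(5) by (auto simp: contracts_edge_def)
  have "\<Omega> (iso_class G) vs = counit \<eta> (prod_list vs * euler_element scale Basis \<eta> ^ g)"
    if vs: "length vs = length (rot G)" for vs
  proof -
    let ?ws = "remove_nth j (vs[i := vs ! i * vs ! j])"
    have "G' \<in> cell_graphs g (length (rot G) - 1)" using g(1) edge(6) by simp
    then have "\<Omega> (iso_class G) vs = \<Omega> (iso_class G') ?ws"
      using assms(2) G edge(5) vs unfolding ECA1_def by blast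
    moreover have "length ?ws = length (rot G')" using vs ij edge(6) by (simp add: remove_nth_def)
    moreover have "prod_list ?ws = prod_list vs" using prod_list_remove_nth_mult ij vs by metis
    ultimately show ?thesis using g(2) by simp
  qed
  then show ?case using G by blast
next
  case (loop_connected G G')
  then obtain g where g: "G' \<in> cell_graphs g 2"
    "\<And>vs. length vs = 2 \<Longrightarrow>
      \<Omega> (iso_class G') vs = counit \<eta> (prod_list vs * euler_element scale Basis \<eta> ^ g)" by auto
  \<comment> \<open>From 2 - 2g the Euler characteristic drops by 2, to 2 - 2(g + 1).\<close>
  have G: "G \<in> cell_graphs (Suc g) (length (rot G))" using loop_connected g(1) by (simp add: mem_cell_graphs_iff)
  have "\<Omega> (iso_class G) vs = counit \<eta> (prod_list vs * euler_element scale Basis \<eta> ^ Suc g)"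
    if vs: "length vs = length (rot G)" for vs
  proof -
    have "length vs = Suc 0" using vs loop_connected(3) by simp
    then obtain v where v: "vs = [v]" by (auto simp: length_Suc_conv)
    have g_pos: "1 \<le> Suc g" by simp
    have "G' \<in> cell_graphs (Suc g - 1) (length (rot G) + 1)"
      using g(1) loop_connected(3) by (simp add: numeral_2_eq_2)
    then have "\<Omega> (iso_class G) vs = (\<Sum>a\<in>Basis. \<Sum>b\<in>Basis.
        comult Basis \<eta> (vs ! 0) a b * \<Omega> (iso_class G') (replace_by_two 0 a b vs))"
      using assms(3) G loop_connected(7) vs g_pos unfolding ECA2_connected_def by blast
    also have "\<dots> = (\<Sum>a\<in>Basis. \<Sum>b\<in>Basis.
        comult Basis \<eta> v a b * counit \<eta> (a * b * euler_element scale Basis \<eta> ^ g))"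
      by (intro sum.cong refl) (simp add: v replace_by_two_def g(2))
    finally show ?thesis by (simp add: comult_counit_euler v)
  qed
  then show ?case using G by blast
next
  case (loop_disconnected G G1 G2)
  let ?e = "euler_element scale Basis \<eta>"
  obtain g1 where g1: "G1 \<in> cell_graphs g1 1"
    "\<And>vs. length vs = 1 \<Longrightarrow> \<Omega> (iso_class G1) vs = counit \<eta> (prod_list vs * ?e ^ g1)"
    using loop_disconnected by auto
  obtain g2 where g2: "G2 \<in> cell_graphs g2 1"
    "\<And>vs. length vs = 1 \<Longrightarrow> \<Omega> (iso_class G2) vs = counit \<eta> (prod_list vs * ?e ^ g2)"
    using loop_disconnected by auto
  \<comment> \<open>The genera add up since (2 - 2 g1) + (2 - 2 g2) - 2 = 2 - 2(g1 + g2).\<close>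
  have G: "G \<in> cell_graphs (g1 + g2) (length (rot G))"
    using loop_disconnected g1(1) g2(1) by (simp add: mem_cell_graphs_iff)
  have "\<Omega> (iso_class G) vs = counit \<eta> (prod_list vs * ?e ^ (g1 + g2))"
    if vs: "length vs = length (rot G)" for vs
  proof -
    have "length vs = Suc 0" using vs loop_disconnected(3) by simp
    then obtain v where v: "vs = [v]" by (auto simp: length_Suc_conv)
    have "G1 \<in> cell_graphs g1 (card ({} :: nat set) + 1)" "G2 \<in> cell_graphs g2 (card ({} :: nat set) + 1)"
      using g1(1) g2(1) by simp_all
    then have "\<Omega> (iso_class G) vs = (\<Sum>a\<in>Basis. \<Sum>b\<in>Basis. comult Basis \<eta> (vs ! 0) a b *
        \<Omega> (iso_class G1) (nths (vs[0 := a]) {0}) * \<Omega> (iso_class G2) (nths (vs[0 := b]) {0}))"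
      using assms(4) G loop_disconnected(10) vs unfolding ECA2_disconnected_def by blast
    also have "\<dots> = (\<Sum>a\<in>Basis. \<Sum>b\<in>Basis.
        comult Basis \<eta> v a b * counit \<eta> (a * ?e ^ g1) * counit \<eta> (b * ?e ^ g2))"
      by (intro sum.cong refl) (simp add: v nths_singleton g1(2) g2(2))
    finally show ?thesis by (simp add: comult_counit_counit v power_add)
  qed
  then show ?case using G by blast
qed

theorem theorem4p7:
  fixes scale :: "'k::field \<Rightarrow> 'a::{comm_ring, comm_monoid_mult} \<Rightarrow> 'a"
    and B :: "'a set"
    and \<eta> :: "'a \<Rightarrow> 'a \<Rightarrow> 'k"
    and \<Omega> :: "cell_graph set \<Rightarrow> 'a list \<Rightarrow> 'k"
  assumes "frobenius_algebra scale B \<eta>"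
    and "\<And>g n \<gamma>. n \<ge> 1 \<Longrightarrow> \<gamma> \<in> Gamma g n \<Longrightarrow> multilinear_form scale n (\<Omega> \<gamma>)"
    and "ECA0 \<eta> \<Omega>"
    and "ECA1 \<Omega>"
    and "ECA2_connected B \<eta> \<Omega>"
    and "ECA2_disconnected B \<eta> \<Omega>"
  shows "\<forall>g n. n \<ge> 1 \<longrightarrow>
     (\<forall>\<gamma> \<in> Gamma g n. \<forall>vs. length vs = n \<longrightarrow>
        \<Omega> \<gamma> vs = counit \<eta> (prod_list vs * euler_element scale B \<eta> ^ g)) \<and>
     (\<forall>\<gamma> \<in> Gamma g n. \<forall>\<gamma>' \<in> Gamma g n. \<forall>vs. length vs = n \<longrightarrow> \<Omega> \<gamma> vs = \<Omega> \<gamma>' vs) \<and>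
     (\<forall>\<gamma> \<in> Gamma g n. \<forall>vs \<pi>. length vs = n \<longrightarrow> \<pi> permutes {..<n} \<longrightarrow>
        \<Omega> \<gamma> (permute_list \<pi> vs) = \<Omega> \<gamma> vs)"
proof -
  interpret frobenius_algebra scale B \<eta> by (rule assms(1))
  have main: "\<Omega> \<gamma> vs = counit \<eta> (prod_list vs * euler_element scale B \<eta> ^ g)"
    if mem: "\<gamma> \<in> Gamma g n" and vs: "length vs = n" for g n \<gamma> vs
  proof -
    obtain G where G: "G \<in> cell_graphs g n" "\<gamma> = iso_class G" using mem by (auto simp: Gamma_def)
    then obtain g' where "G \<in> cell_graphs g' n"
      "\<Omega> \<gamma> vs = counit \<eta> (prod_list vs * euler_element scale B \<eta> ^ g')"
      using edge_contraction_formula[OF assms(3-6), of G] vs by (auto simp: mem_cell_graphs_iff)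
    moreover from this have "g' = g" using G(1) by (simp add: mem_cell_graphs_iff)
    ultimately show ?thesis by simp
  qed
  \<comment> \<open>Symmetry in the arguments: the product depends only on the multiset of
    entries.\<close>
  have perm: "prod_list (permute_list \<pi> vs) = prod_list vs"
    if "\<pi> permutes {..<length vs}" for \<pi> and vs :: "'a list"
    using mset_permute_list[OF that] by (metis prod_mset_prod_list)
  show ?thesis
    using main perm by (auto simp: length_permute_list)
qed

end
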